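(* Let $M$ be an orientable $(2,3)$ sub-Riemannian manifold with sub-Riemannian structure $(\mathcal{H},\langle\cdot,\cdot\rangle)$ and associated co-metric $g$. Let $U\subseteq M$ be open, $p\in U$, let $\{X_1,X_2\}$ be an ordered orthonormal frame of $\mathcal{H}$ on $U$, and let $X_3=[X_1,X_2]$. The following are equivalent. (a) $\{X_1,X_2\}$ is a Carnot frame for $\mathcal{H}$ at $p$. (b) On some open neighborhood $\hat U\subseteq U$ of $p$, there exists a flattening of $g$ at $p$ with frame $\{\hat X_1,\hat X_2,\hat X_3\}$ such that, for all multi-indices $\alpha$ of weighted order $1$, $2$ or $3$, $\hat X^\alpha_p=X^\alpha_p$ as differential operators on smooth functions at $p$.
   Context: A sub-Riemannian structure on a smooth manifold $M$ is a pair $(\mathcal{H},\langle\cdot,\cdot\rangle)$ with $\mathcal{H}$ a smooth sub-bundle of $TM$ and $\langle\cdot,\cdot\rangle$ a smooth fiber inner product on $\mathcal{H}$. A $(2,3)$ sub-Riemannian manifold is a smooth $3$-manifold with such a structure in which $\mathcal{H}$ has rank $2$ and, at every point, $\mathcal{H}$ together with brackets of local sections of $\mathcal{H}$ spans the tangent space. The associated co-metric is $g=X_1\otimes X_1+X_2\otimes X_2$ locally, for any orthonormal frame $\{X_1,X_2\}$ of $\mathcal{H}$. A Carnot frame for $\mathcal{H}$ at $p\in U$ is an ordered orthonormal frame $\{X_1,X_2\}$ of $\mathcal{H}$ on $U$ such that, with $X_3=[X_1,X_2]$, $[X_1,X_3]_p=0$ and $[X_2,X_3]_p=0$. Weighted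 order: for a multi-index $\alpha=(\alpha_1,\dots,\alpha_N)$ with $\alpha_i\in\{1,2,3\}$, $X^\alpha_p$ is the differential operator $f\mapsto (X_{\alpha_1}\cdots X_{\alpha_N}f)(p)$ on smooth functions (similarly $\hat X^\alpha_p$), and the weighted order of $\alpha$ is the number of $\alpha_i\in\{1,2\}$ plus twice the number of $\alpha_i=3$. Flattening: let $\hat U$ be an open neighborhood of $p$ and $\{\hat X_1,\hat X_2,\hat X_3\}$ a frame of $T\hat U$ with $[\hat X_1,\hat X_2]=\hat X_3$, $[\hat X_3,\hat X_1]=0$, $[\hat X_2,\hat X_3]=0$ on $\hat U$. Then $\hat g=\hat X_1\otimes\hat X_1+\hat X_2\otimes\hat X_2$ is a flattening of $g$ at $p$ with frame $\{\hat X_1,\hat X_2,\hat X_3\}$ if there is an ordered orthonormal frame $\{Y_1,Y_2\}$ of $\mathcal{H}$ on $\hat U$ (with $Y_3=[Y_1,Y_2]$) such that $\hat X^\alpha_p=Y^\alpha_p$ for all multi-indices $\alpha$ of weighted order $1$, $2$ or $3$. *)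

theory Defs
  imports "HOL-Analysis.Analysis" "HOL-Library.Function_Algebras"
begin

text \<open>Tangent vectors are real-valued operators on functions.  Making function types real vector
  spaces (pointwise operations) gives access to \<open>span\<close> and \<open>independent\<close> for them.\<close>

instantiation "fun" :: (type, real_vector) real_vector
begin

definition scaleR_fun :: "real \<Rightarrow> ('a \<Rightarrow> 'b) \<Rightarrow> 'a \<Rightarrow> 'b"
  where "scaleR_fun c f = (\<lambda>x. c *\<^sub>R f x)"

instance
  by standard (auto simp: scaleR_fun_def fun_eq_iff scaleR_add_right scaleR_add_left)

end

section \<open>Smooth maps between Euclidean spaces\<close>

text \<open>Only meant for open \<open>S\<close>.\<close>

primrec Ck_on :: "nat \<Rightarrow> 'a::euclidean_space set \<Rightarrow> ('a \<Rightarrow> 'b::real_normed_vector) \<Rightarrow> bool" where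
  "Ck_on 0 S f \<longleftrightarrow> continuous_on S f"
| "Ck_on (Suc k) S f \<longleftrightarrow>
     f differentiable_on S \<and> (\<forall>b\<in>Basis. Ck_on k S (\<lambda>x. frechet_derivative f (at x) b))"

definition smooth_map_on :: "'a::euclidean_space set \<Rightarrow> ('a \<Rightarrow> 'b::real_normed_vector) \<Rightarrow> bool"
  where "smooth_map_on S f \<longleftrightarrow> (\<forall>k. Ck_on k S f)"

section \<open>Smooth 3-manifolds\<close>

text \<open>The manifold is the whole (Hausdorff, second countable) type \<open>'a\<close>.
  A chart is a domain together with a coordinate map; values of the coordinate map outside
  the domain are irrelevant.\<close>

type_synonym 'a chart = "'a set \<times> ('a \<Rightarrow> real ^ 3)"

definition chart :: "'a::topological_space chart \<Rightarrow> bool"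
  where "chart = (\<lambda>(D, \<phi>). open D \<and> open (\<phi> ` D) \<and> homeomorphism D (\<phi> ` D) \<phi> (inv_into D \<phi>))"

definition smooth_transition :: "'a chart \<Rightarrow> 'a chart \<Rightarrow> bool"
  where "smooth_transition = (\<lambda>(D, \<phi>) (E, \<psi>). smooth_map_on (\<phi> ` (D \<inter> E)) (\<psi> \<circ> inv_into D \<phi>))"

definition smooth_atlas :: "'a::topological_space chart set \<Rightarrow> bool"
  where "smooth_atlas A \<longleftrightarrow>
    (\<forall>c\<in>A. chart c) \<and> (\<forall>c\<in>A. \<forall>d\<in>A. smooth_transition c d) \<and> (\<Union>c\<in>A. fst c) = UNIV"

definition orientable :: "'a::topological_space chart set \<Rightarrow> bool"
  where "orientable A \<longleftrightarrow>
    (\<exists>B. smooth_atlas B \<and> smooth_atlas (A \<union> B) \<and>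
      (\<forall>(D, \<phi>)\<in>B. \<forall>(E, \<psi>)\<in>B. \<forall>x\<in>\<phi> ` (D \<inter> E).
        det (matrix (frechet_derivative (\<psi> \<circ> inv_into D \<phi>) (at x))) > 0))"

definition smooth_fun_on :: "'a chart set \<Rightarrow> 'a set \<Rightarrow> ('a \<Rightarrow> real) \<Rightarrow> bool"
  where "smooth_fun_on A W f \<longleftrightarrow> (\<forall>(D, \<phi>)\<in>A. smooth_map_on (\<phi> ` (D \<inter> W)) (f \<circ> inv_into D \<phi>))"

definition smooth_at :: "'a::topological_space chart set \<Rightarrow> 'a \<Rightarrow> ('a \<Rightarrow> real) \<Rightarrow> bool"
  where "smooth_at A p f \<longleftrightarrow> (\<exists>W. open W \<and> p \<in> W \<and> smooth_fun_on A W f)"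

section \<open>Tangent vectors, vector fields, frames\<close>

type_synonym 'a tvec = "('a \<Rightarrow> real) \<Rightarrow> real"
type_synonym 'a vfield = "'a \<Rightarrow> 'a tvec"

text \<open>Derivations on germs at \<open>p\<close> of smooth functions.  A tangent vector is made to vanish on
  functions that are not smooth near \<open>p\<close>, so that equality of operators is equality of
  derivations.\<close>

definition tangent_space :: "'a::topological_space chart set \<Rightarrow> 'a \<Rightarrow> 'a tvec set"
  where "tangent_space A p = {v.
    (\<forall>f h. smooth_at A p f \<and> smooth_at A p h \<longrightarrow>
       v (\<lambda>x. f x + h x) = v f + v h \<and>
       v (\<lambda>x. f x * h x) = f p * v h + h p * v f) \<and>
    (\<forall>f c. smooth_at A p f \<longrightarrow> v (\<lambda>x. c * f x) = c * v f) \<and>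
    (\<forall>f h. smooth_at A p f \<and> smooth_at A p h \<and> (\<forall>\<^sub>F x in nhds p. f x = h x) \<longrightarrow> v f = v h) \<and>
    (\<forall>f. \<not> smooth_at A p f \<longrightarrow> v f = 0)}"

definition smooth_vfield_on :: "'a::topological_space chart set \<Rightarrow> 'a set \<Rightarrow> 'a vfield \<Rightarrow> bool"
  where "smooth_vfield_on A U X \<longleftrightarrow>
    (\<forall>q\<in>U. X q \<in> tangent_space A q) \<and>
    (\<forall>W f. open W \<and> W \<subseteq> U \<and> smooth_fun_on A W f \<longrightarrow> smooth_fun_on A W (\<lambda>q. X q f))"

text \<open>The case distinction keeps the bracket extensional in the sense of \<open>tangent_space\<close>.\<close>

definition bracket :: "'a::topological_space chart set \<Rightarrow> 'a vfield \<Rightarrow> 'a vfield \<Rightarrow> 'a vfield"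
  where "bracket A X Y q = (\<lambda>f. if smooth_at A q f
    then X q (\<lambda>r. Y r f) - Y q (\<lambda>r. X r f) else 0)"

definition smooth_section_on ::
    "'a::topological_space chart set \<Rightarrow> 'a set \<Rightarrow> ('a \<Rightarrow> 'a tvec set) \<Rightarrow> 'a vfield \<Rightarrow> bool"
  where "smooth_section_on A U E X \<longleftrightarrow> smooth_vfield_on A U X \<and> (\<forall>q\<in>U. X q \<in> E q)"

definition frame_on ::
    "'a::topological_space chart set \<Rightarrow> 'a set \<Rightarrow> ('a \<Rightarrow> 'a tvec set) \<Rightarrow> 'a vfield list \<Rightarrow> bool"
  where "frame_on A U E Xs \<longleftrightarrow>
    (\<forall>X\<in>set Xs. smooth_section_on A U E X) \<and>
    (\<forall>q\<in>U. distinct (map (\<lambda>X. X q) Xs) \<and>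
           independent (set (map (\<lambda>X. X q) Xs)) \<and>
           span (set (map (\<lambda>X. X q) Xs)) = E q)"

text \<open>A smooth sub-bundle of the tangent bundle, given by its fibers, via local frames.\<close>

definition smooth_subbundle ::
    "'a::topological_space chart set \<Rightarrow> nat \<Rightarrow> ('a \<Rightarrow> 'a tvec set) \<Rightarrow> bool"
  where "smooth_subbundle A k H \<longleftrightarrow>
    (\<forall>p. \<exists>U Xs. open U \<and> p \<in> U \<and> length Xs = k \<and> frame_on A U H Xs)"

section \<open>Sub-Riemannian structures\<close>

definition inner_product_on :: "'v::real_vector set \<Rightarrow> ('v \<Rightarrow> 'v \<Rightarrow> real) \<Rightarrow> bool"
  where "inner_product_on V B \<longleftrightarrow>
    (\<forall>u\<in>V. \<forall>v\<in>V. B u v = B v u) \<and>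
    (\<forall>u\<in>V. \<forall>v\<in>V. \<forall>w\<in>V. B (u + v) w = B u w + B v w) \<and>
    (\<forall>u\<in>V. \<forall>v\<in>V. \<forall>c. B (c *\<^sub>R u) v = c * B u v) \<and>
    (\<forall>u\<in>V. u \<noteq> 0 \<longrightarrow> B u u > 0)"

definition smooth_fiber_inner_product ::
    "'a::topological_space chart set \<Rightarrow> ('a \<Rightarrow> 'a tvec set) \<Rightarrow> ('a \<Rightarrow> 'a tvec \<Rightarrow> 'a tvec \<Rightarrow> real) \<Rightarrow> bool"
  where "smooth_fiber_inner_product A H ip \<longleftrightarrow>
    (\<forall>q. inner_product_on (H q) (ip q)) \<and>
    (\<forall>W X Y. open W \<and> smooth_section_on A W H X \<and> smooth_section_on A W H Y \<longrightarrow>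
       smooth_fun_on A W (\<lambda>q. ip q (X q) (Y q)))"

definition sub_riemannian_23 ::
    "'a::topological_space chart set \<Rightarrow> ('a \<Rightarrow> 'a tvec set) \<Rightarrow> ('a \<Rightarrow> 'a tvec \<Rightarrow> 'a tvec \<Rightarrow> real) \<Rightarrow> bool"
  where "sub_riemannian_23 A H ip \<longleftrightarrow>
    smooth_atlas A \<and> smooth_subbundle A 2 H \<and> smooth_fiber_inner_product A H ip \<and>
    (\<forall>p. span (H p \<union> {bracket A X Y p | X Y. \<exists>W. open W \<and> p \<in> W \<and>
                       smooth_section_on A W H X \<and> smooth_section_on A W H Y})
         = tangent_space A p)"

definition orthonormal_frame ::
    "'a::topological_space chart set \<Rightarrow> ('a \<Rightarrow> 'a tvec set) \<Rightarrow> ('a \<Rightarrow> 'a tvec \<Rightarrow> 'a tvec \<Rightarrow> real)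
      \<Rightarrow> 'a set \<Rightarrow> 'a vfield \<Rightarrow> 'a vfield \<Rightarrow> bool"
  where "orthonormal_frame A H ip U X1 X2 \<longleftrightarrow>
    frame_on A U H [X1, X2] \<and>
    (\<forall>q\<in>U. ip q (X1 q) (X1 q) = 1 \<and> ip q (X2 q) (X2 q) = 1 \<and> ip q (X1 q) (X2 q) = 0)"

definition cotangent_space :: "'a::topological_space chart set \<Rightarrow> 'a \<Rightarrow> ('a tvec \<Rightarrow> real) set"
  where "cotangent_space A q = {\<xi>.
    (\<forall>v\<in>tangent_space A q. \<forall>w\<in>tangent_space A q. \<xi> (v + w) = \<xi> v + \<xi> w) \<and>
    (\<forall>v\<in>tangent_space A q. \<forall>c. \<xi> (c *\<^sub>R v) = c * \<xi> v)}"

text \<open>A co-metric assigns to each point a bilinear form on the cotangent space;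
  \<open>X \<otimes> X\<close> is the form \<open>(\<xi>, \<eta>) \<mapsto> \<xi> X * \<eta> X\<close>.\<close>

type_synonym 'a cometric = "'a \<Rightarrow> ('a tvec \<Rightarrow> real) \<Rightarrow> ('a tvec \<Rightarrow> real) \<Rightarrow> real"

definition cometric_of_frame ::
    "'a::topological_space chart set \<Rightarrow> 'a set \<Rightarrow> 'a vfield \<Rightarrow> 'a vfield \<Rightarrow> 'a cometric \<Rightarrow> bool"
  where "cometric_of_frame A U X1 X2 g \<longleftrightarrow>
    (\<forall>q\<in>U. \<forall>\<xi>\<in>cotangent_space A q. \<forall>\<eta>\<in>cotangent_space A q.
       g q \<xi> \<eta> = \<xi> (X1 q) * \<eta> (X1 q) + \<xi> (X2 q) * \<eta> (X2 q))"

definition associated_cometric ::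
    "'a::topological_space chart set \<Rightarrow> ('a \<Rightarrow> 'a tvec set) \<Rightarrow> ('a \<Rightarrow> 'a tvec \<Rightarrow> 'a tvec \<Rightarrow> real)
      \<Rightarrow> 'a cometric \<Rightarrow> bool"
  where "associated_cometric A H ip g \<longleftrightarrow>
    (\<forall>U X1 X2. open U \<and> orthonormal_frame A H ip U X1 X2 \<longrightarrow> cometric_of_frame A U X1 X2 g)"

definition carnot_frame ::
    "'a::topological_space chart set \<Rightarrow> ('a \<Rightarrow> 'a tvec set) \<Rightarrow> ('a \<Rightarrow> 'a tvec \<Rightarrow> 'a tvec \<Rightarrow> real)
      \<Rightarrow> 'a set \<Rightarrow> 'a \<Rightarrow> 'a vfield \<Rightarrow> 'a vfield \<Rightarrow> bool"
  where "carnot_frame A H ip U p X1 X2 \<longleftrightarrow>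
    open U \<and> p \<in> U \<and> orthonormal_frame A H ip U X1 X2 \<and>
    (let X3 = bracket A X1 X2 in bracket A X1 X3 p = 0 \<and> bracket A X2 X3 p = 0)"

section \<open>Multi-indices and flattenings\<close>

definition multi_index :: "nat list \<Rightarrow> bool"
  where "multi_index \<alpha> \<longleftrightarrow> set \<alpha> \<subseteq> {1, 2, 3}"

definition weighted_order :: "nat list \<Rightarrow> nat"
  where "weighted_order \<alpha> =
    length (filter (\<lambda>i. i \<in> {1, 2}) \<alpha>) + 2 * length (filter (\<lambda>i. i = 3) \<alpha>)"

text \<open>The frame fields are numbered from 1, whereas list positions start at 0.\<close>

definition multi_apply :: "'a vfield list \<Rightarrow> nat list \<Rightarrow> ('a \<Rightarrow> real) \<Rightarrow> 'a \<Rightarrow> real"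
  where "multi_apply Xs \<alpha> f = foldr (\<lambda>i h. \<lambda>q. (Xs ! (i - 1)) q h) \<alpha> f"

definition agree_at ::
    "'a::topological_space chart set \<Rightarrow> 'a \<Rightarrow> 'a vfield list \<Rightarrow> 'a vfield list \<Rightarrow> nat list \<Rightarrow> bool"
  where "agree_at A p Xs Ys \<alpha> \<longleftrightarrow>
    (\<forall>f. smooth_at A p f \<longrightarrow> multi_apply Xs \<alpha> f p = multi_apply Ys \<alpha> f p)"

text \<open>\<open>ghat\<close> with frame \<open>Xh1, Xh2, Xh3\<close> on \<open>Uh\<close> is a flattening at \<open>p\<close> of the co-metric \<open>g\<close>
  associated with \<open>(H, ip)\<close>.\<close>

definition flattening ::
    "'a::topological_space chart set \<Rightarrow> ('a \<Rightarrow> 'a tvec set) \<Rightarrow> ('a \<Rightarrow> 'a tvec \<Rightarrow> 'a tvec \<Rightarrow> real)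
      \<Rightarrow> 'a cometric \<Rightarrow> 'a \<Rightarrow> 'a set \<Rightarrow> 'a cometric \<Rightarrow> 'a vfield \<Rightarrow> 'a vfield \<Rightarrow> 'a vfield \<Rightarrow> bool"
  where "flattening A H ip g p Uh ghat Xh1 Xh2 Xh3 \<longleftrightarrow>
    associated_cometric A H ip g \<and> open Uh \<and> p \<in> Uh \<and>
    frame_on A Uh (tangent_space A) [Xh1, Xh2, Xh3] \<and>
    (\<forall>q\<in>Uh. bracket A Xh1 Xh2 q = Xh3 q \<and> bracket A Xh3 Xh1 q = 0 \<and> bracket A Xh2 Xh3 q = 0) \<and>
    cometric_of_frame A Uh Xh1 Xh2 ghat \<and>
    (\<exists>Y1 Y2. orthonormal_frame A H ip Uh Y1 Y2 \<and>
       (\<forall>\<alpha>. multi_index \<alpha> \<and> weighted_order \<alpha> \<in> {1, 2, 3} \<longrightarrow>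
          agree_at A p [Xh1, Xh2, Xh3] [Y1, Y2, bracket A Y1 Y2] \<alpha>))"

end

theory Submission
  imports Defs
begin

text \<open>A flattening forces the Carnot condition because \<open>[X\<^sub>i, X\<^sub>3]\<close> at \<open>p\<close> is a difference
  of operators of weighted order 3, which agree with those of the Heisenberg fields.

  Conversely, at a Carnot point the operators \<open>X\<^sup>\<alpha>\<close> at \<open>p\<close> of weighted order at most 3 satisfy
  the same linear relations as those of the Heisenberg group, so there are smooth functions
  \<open>u\<^sub>1, u\<^sub>2, u\<^sub>3\<close> on which they take the values they would take on the coordinates \<open>x, y, z\<close> for
  the fields \<open>\<partial>\<^sub>x\<close>, \<open>\<partial>\<^sub>y + x \<partial>\<^sub>z\<close>, \<open>\<partial>\<^sub>z\<close>.  Inverting the matrix \<open>X\<^sub>j u\<^sub>k\<close>, which is the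
  identity at \<open>p\<close>, gives fields near \<open>p\<close> acting on the \<open>u\<^sub>k\<close> exactly as the Heisenberg fields act on
  \<open>x, y, z\<close>; as the \<open>u\<^sub>k\<close> determine tangent vectors, their brackets are as required.  The
  coefficients by which they differ from the \<open>X\<^sub>i\<close> vanish at \<open>p\<close> to an order that does not affect
  operators of weighted order at most 3.\<close>

section \<open>Locality and algebra of C^k maps on open Euclidean sets\<close>

section \<open>Smooth maps\<close>

text \<open>\<open>frechet_derivative\<close> is chosen among the maps satisfying
  \<open>has_derivative\<close>, so it suffices that f and g have the same derivatives at x.\<close>

lemma frechet_derivative_cong_open:
  assumes "open S" "x \<in> S" "\<And>y. y \<in> S \<Longrightarrow> f y = g y"
  shows "frechet_derivative f (at x) = frechet_derivative g (at x)"
proof -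
  have "(f has_derivative F) (at x) \<longleftrightarrow> (g has_derivative F) (at x)" for F
    using has_derivative_transform_within_open[of f F x UNIV S g]
      has_derivative_transform_within_open[of g F x UNIV S f] assms by auto
  then show ?thesis
    by (simp add: frechet_derivative_def)
qed

lemma Ck_on_subset: "Ck_on k S f \<Longrightarrow> T \<subseteq> S \<Longrightarrow> Ck_on k T f"
  by (induction k arbitrary: f)
    (auto intro: continuous_on_subset differentiable_on_subset)

lemma Ck_on_cong:
  assumes "open S" "\<And>x. x \<in> S \<Longrightarrow> f x = g x" "Ck_on k S f"
  shows "Ck_on k S g"
  using assms(2,3)
proof (induction k arbitrary: f g)
  case 0
  then show ?case
    using continuous_on_cong[of S S f g] by simp
next
  case (Suc k)
  have d: "frechet_derivative f (at x) = frechet_derivative g (at x)" if "x \<in> S" for x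
    using frechet_derivative_cong_open[OF assms(1) that] Suc.prems(1) by blast
  have "g differentiable_on S"
    unfolding differentiable_on_def
  proof
    fix x assume x: "x \<in> S"
    then have "f differentiable at x within S"
      using Suc.prems(2) by (simp add: differentiable_on_def)
    then show "g differentiable at x within S"
      by (rule differentiable_transform_within[OF _ zero_less_one x]) (use Suc.prems(1) in auto)
  qed
  moreover have "Ck_on k S (\<lambda>x. frechet_derivative g (at x) b)" if "b \<in> Basis" for b
    by (rule Suc.IH[of "\<lambda>x. frechet_derivative f (at x) b"]) (use Suc.prems that d in auto)
  ultimately show ?case
    by simp
qed

lemma Ck_on_Suc_imp: "Ck_on (Suc k) S f \<Longrightarrow> Ck_on k S f"
proof (induction k arbitrary: f)
  case 0
  then show ?case
    by (simp add: differentiable_imp_continuous_on)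
next
  case (Suc k)
  then show ?case by (meson Ck_on.simps(2))
qed

text \<open>The derivatives iterated in \<open>Ck_on\<close> are taken \<open>at x\<close> and so do
  not depend on S; the open sets T may therefore reach outside S. This turns smoothness near each
  point into smoothness on a set.\<close>

lemma Ck_on_locally:
  assumes "\<And>x. x \<in> S \<Longrightarrow> \<exists>T. open T \<and> x \<in> T \<and> Ck_on k T f"
  shows "Ck_on k S f"
  using assms
proof (induction k arbitrary: f)
  case 0
  have "continuous (at x within S) f" if x: "x \<in> S" for x
  proof -
    obtain T where "open T" "x \<in> T" "continuous_on T f"
      using 0[OF x] by auto
    then have "continuous (at x) f"
      by (simp add: continuous_on_eq_continuous_at)
    then show ?thesis
      using continuous_at_imp_continuous_at_within by blast
  qed
  then show ?case
    by (simp add: continuous_on_eq_continuous_within)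
next
  case (Suc k)
  have "f differentiable at x within S" if x: "x \<in> S" for x
  proof -
    obtain T where "open T" "x \<in> T" "f differentiable_on T"
      using Suc.prems[OF x] by auto
    then show ?thesis
      by (meson differentiable_at_withinI differentiable_on_eq_differentiable_at)
  qed
  moreover have "Ck_on k S (\<lambda>x. frechet_derivative f (at x) b)" if "b \<in> Basis" for b
  proof (rule Suc.IH)
    fix x assume "x \<in> S"
    then show "\<exists>T. open T \<and> x \<in> T \<and> Ck_on k T (\<lambda>x. frechet_derivative f (at x) b)"
      using Suc.prems that unfolding Ck_on.simps by blast
  qed
  ultimately show ?case
    by (auto simp: differentiable_on_def)
qed

text \<open>Any explicit formula for the derivative can stand in for
  \<open>frechet_derivative\<close>, which turns the closure properties below into inductions on
  k.\<close>

lemma Ck_on_SucI: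
  assumes "open S" "\<And>x. x \<in> S \<Longrightarrow> (f has_derivative f' x) (at x)"
    "\<And>b. b \<in> Basis \<Longrightarrow> Ck_on k S (\<lambda>x. f' x b)"
  shows "Ck_on (Suc k) S f"
proof -
  have "f differentiable_on S"
    using assms(1,2) by (meson differentiable_at_withinI differentiable_def differentiable_on_def)
  moreover have "Ck_on k S (\<lambda>x. frechet_derivative f (at x) b)" if b: "b \<in> Basis" for b
    using assms(1) _ assms(3)[OF b]
    by (rule Ck_on_cong) (metis assms(2) frechet_derivative_at)
  ultimately show ?thesis
    by simp
qed

lemma Ck_on_Suc_has_derivative:
  assumes "open S" "Ck_on (Suc k) S f" "x \<in> S"
  shows "(f has_derivative frechet_derivative f (at x)) (at x)"
  using assms by (auto simp: differentiable_on_eq_differentiable_at frechet_derivative_works)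

lemma Ck_on_const:
  assumes "open S"
  shows "Ck_on k S (\<lambda>_. c)"
proof (induction k arbitrary: c)
  case (Suc k)
  show ?case
    by (rule Ck_on_SucI[OF assms, where f' = "\<lambda>_ _. 0"]) (auto intro: Suc.IH)
qed simp

lemma Ck_on_add:
  assumes "open S" "Ck_on k S f" "Ck_on k S g"
  shows "Ck_on k S (\<lambda>x. f x + g x)"
  using assms(2,3)
proof (induction k arbitrary: f g)
  case (Suc k)
  show ?case
  proof (rule Ck_on_SucI[OF assms(1)])
    fix x assume "x \<in> S"
    then show "((\<lambda>x. f x + g x) has_derivative
        (\<lambda>b. frechet_derivative f (at x) b + frechet_derivative g (at x) b)) (at x)"
      using Suc.prems assms(1) by (intro has_derivative_add Ck_on_Suc_has_derivative)
  qed (use Suc in auto)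
qed (auto intro: continuous_intros)

lemma Ck_on_mult:
  fixes f g :: "'a::euclidean_space \<Rightarrow> 'b::real_normed_algebra"
  assumes "open S" "Ck_on k S f" "Ck_on k S g"
  shows "Ck_on k S (\<lambda>x. f x * g x)"
  using assms(2,3)
proof (induction k arbitrary: f g)
  case (Suc k)
  show ?case
  proof (rule Ck_on_SucI[OF assms(1)])
    fix x assume "x \<in> S"
    then show "((\<lambda>x. f x * g x) has_derivative
        (\<lambda>b. f x * frechet_derivative g (at x) b + frechet_derivative f (at x) b * g x)) (at x)"
      using Suc.prems assms(1) by (intro has_derivative_mult Ck_on_Suc_has_derivative)
  next
    fix b :: 'a assume "b \<in> Basis"
    \<comment> \<open>The product rule leaves one factor undifferentiated; its regularity is lowered
      from \<open>Suc k\<close> to k so that the induction hypothesis applies.\<close>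
    then show "Ck_on k S (\<lambda>x. f x * frechet_derivative g (at x) b + frechet_derivative f (at x) b * g x)"
      using Suc.prems Ck_on_Suc_imp[of k S f] Ck_on_Suc_imp[of k S g]
      by (intro Ck_on_add[OF assms(1)] Suc.IH) auto
  qed
qed (auto intro: continuous_intros)

lemma Ck_on_inverse:
  fixes f :: "'a::euclidean_space \<Rightarrow> real"
  assumes "open S" "Ck_on k S f" "\<And>x. x \<in> S \<Longrightarrow> f x \<noteq> 0"
  shows "Ck_on k S (\<lambda>x. inverse (f x))"
  using assms(2)
proof (induction k)
  case (Suc k)
  show ?case
  proof (rule Ck_on_SucI[OF assms(1)])
    fix x assume x: "x \<in> S"
    \<comment> \<open>The minus sign is a constant factor and the rest a product, so that closure
      under products reduces the claim to the induction hypothesis for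
      \<open>inverse (f x)\<close>.\<close>
    then show "((\<lambda>x. inverse (f x)) has_derivative
        (\<lambda>b. (- 1) * (inverse (f x) * frechet_derivative f (at x) b * inverse (f x)))) (at x)"
      using Deriv.has_derivative_inverse[OF assms(3)[OF x] Ck_on_Suc_has_derivative[OF assms(1) Suc.prems x]]
      by simp
  next
    fix b :: 'a assume "b \<in> Basis"
    then show "Ck_on k S (\<lambda>x. (- 1) * (inverse (f x) * frechet_derivative f (at x) b * inverse (f x)))"
      using Suc Ck_on_Suc_imp[of k S f] by (intro Ck_on_mult Ck_on_const assms(1)) auto
  qed
qed (use assms(3) in \<open>auto intro: continuous_intros\<close>)

lemma Ck_on_bounded_linear:
  assumes "open S" "bounded_linear L" "Ck_on k S f"
  shows "Ck_on k S (\<lambda>x. L (f x))"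
  using assms(3)
proof (induction k arbitrary: f)
  case 0
  then show ?case
    using assms(2) by (simp add: bounded_linear.continuous_on)
next
  case (Suc k)
  show ?case
  proof (rule Ck_on_SucI[OF assms(1)])
    fix x assume "x \<in> S"
    then show "((\<lambda>x. L (f x)) has_derivative (\<lambda>b. L (frechet_derivative f (at x) b))) (at x)"
      using bounded_linear.has_derivative[OF assms(2) Ck_on_Suc_has_derivative[OF assms(1) Suc.prems]]
      by simp
  qed (use Suc in auto)
qed

section \<open>Germs of smooth functions, and smoothness of matrix inversion\<close>

section \<open>Smooth functions on a manifold\<close>

lemma matrix_inv_det_nz:
  fixes M :: "real^'n^'n"
  assumes "det M \<noteq> 0"
  shows "M ** matrix_inv M = mat 1" "matrix_inv M ** M = mat 1"
proof -
  have "\<exists>N. M ** N = mat 1 \<and> N ** M = mat 1"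
    using assms by (simp add: invertible_det_nz[symmetric] invertible_def)
  then have "M ** matrix_inv M = mat 1 \<and> matrix_inv M ** M = mat 1"
    unfolding matrix_inv_def by (rule someI_ex)
  then show "M ** matrix_inv M = mat 1" "matrix_inv M ** M = mat 1"
    by auto
qed

locale smooth_manifold =
  fixes A :: "'a::t2_space chart set"
  assumes atlas: "smooth_atlas A"
begin

abbreviation "C_at \<equiv> smooth_at A"
abbreviation "T_at \<equiv> tangent_space A"

lemma chart_facts:
  assumes "(D, \<phi>) \<in> A"
  shows "open D" "inj_on \<phi> D" "continuous_on D \<phi>" "open W \<Longrightarrow> open (\<phi> ` (D \<inter> W))"
proof -
  have D: "open D" "open (\<phi> ` D)" "homeomorphism D (\<phi> ` D) \<phi> (inv_into D \<phi>)"
    using assms atlas by (auto simp: smooth_atlas_def chart_def)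
  then show "open D" "continuous_on D \<phi>" "inj_on \<phi> D"
    by (auto simp: homeomorphism_def intro: inj_on_inverseI)
  assume "open W"
  then have "openin (top_of_set D) (D \<inter> W)"
    by (rule openin_open_Int)
  then show "open (\<phi> ` (D \<inter> W))"
    using homeomorphism_imp_open_map[OF D(3)] D(2) openin_open_trans by blast
qed

lemma chart_exists:
  obtains D \<phi> where "(D, \<phi>) \<in> A" "q \<in> D"
proof -
  have "q \<in> (\<Union>c\<in>A. fst c)"
    using atlas by (simp add: smooth_atlas_def)
  then show ?thesis
    using that by auto
qed

lemma smooth_atI: "smooth_fun_on A W f \<Longrightarrow> open W \<Longrightarrow> q \<in> W \<Longrightarrow> C_at q f"
  unfolding smooth_at_def by blast

lemma smooth_fun_onI:
  assumes "\<And>D \<phi> k. (D, \<phi>) \<in> A \<Longrightarrow> Ck_on k (\<phi> ` (D \<inter> W)) (f \<circ> inv_into D \<phi>)"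
  shows "smooth_fun_on A W f"
  using assms unfolding smooth_fun_on_def smooth_map_on_def by blast

lemma smooth_fun_onD:
  assumes "smooth_fun_on A W f" "(D, \<phi>) \<in> A"
  shows "Ck_on k (\<phi> ` (D \<inter> W)) (f \<circ> inv_into D \<phi>)"
  using assms unfolding smooth_fun_on_def smooth_map_on_def by blast

lemma smooth_fun_on_subset:
  assumes "smooth_fun_on A W f" "V \<subseteq> W"
  shows "smooth_fun_on A V f"
  by (rule smooth_fun_onI, rule Ck_on_subset[OF smooth_fun_onD[OF assms(1)]]) (use assms(2) in auto)

lemma smooth_fun_on_cong:
  assumes "open W" "\<And>x. x \<in> W \<Longrightarrow> f x = h x" "smooth_fun_on A W f"
  shows "smooth_fun_on A W h"
proof (rule smooth_fun_onI)
  fix D \<phi> k assume c: "(D, \<phi>) \<in> A"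
  show "Ck_on k (\<phi> ` (D \<inter> W)) (h \<circ> inv_into D \<phi>)"
  proof (rule Ck_on_cong)
    show "Ck_on k (\<phi> ` (D \<inter> W)) (f \<circ> inv_into D \<phi>)"
      by (rule smooth_fun_onD[OF assms(3) c])
  qed (use chart_facts[OF c] assms in \<open>auto simp: inv_into_f_f\<close>)
qed

text \<open>Smoothness is local by \<open>Ck_on_locally\<close>. Later arguments can thus be made
  with germs, \<open>C_at\<close> and \<open>nhds\<close> in place of domains.\<close>

lemma smooth_fun_on_iff:
  assumes "open W"
  shows "smooth_fun_on A W f \<longleftrightarrow> (\<forall>q\<in>W. C_at q f)"
proof
  assume "smooth_fun_on A W f"
  then show "\<forall>q\<in>W. C_at q f"
    using assms by (auto simp: smooth_at_def)
next
  assume *: "\<forall>q\<in>W. C_at q f"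
  show "smooth_fun_on A W f"
  proof (rule smooth_fun_onI)
    fix D \<phi> k assume c: "(D, \<phi>) \<in> A"
    show "Ck_on k (\<phi> ` (D \<inter> W)) (f \<circ> inv_into D \<phi>)"
    proof (rule Ck_on_locally, safe)
      fix q assume q: "q \<in> D" "q \<in> W"
      then obtain V where V: "open V" "q \<in> V" "smooth_fun_on A V f"
        using * by (auto simp: smooth_at_def)
      have "Ck_on k (\<phi> ` (D \<inter> V)) (f \<circ> inv_into D \<phi>)"
        by (rule smooth_fun_onD[OF V(3) c])
      then show "\<exists>T. open T \<and> \<phi> q \<in> T \<and> Ck_on k T (f \<circ> inv_into D \<phi>)"
        using chart_facts(4)[OF c V(1)] V(2) q by blast
    qed
  qed
qed

lemma smooth_at_eventually:
  assumes "C_at q f"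
  shows "\<forall>\<^sub>F r in nhds q. C_at r f"
  using assms unfolding smooth_at_def eventually_nhds by blast

lemma smooth_at_cong:
  assumes "C_at q f" "\<forall>\<^sub>F r in nhds q. f r = h r"
  shows "C_at q h"
proof -
  obtain W where W: "open W" "q \<in> W" "smooth_fun_on A W f"
    using assms(1) by (auto simp: smooth_at_def)
  obtain V where V: "open V" "q \<in> V" "\<And>r. r \<in> V \<Longrightarrow> f r = h r"
    using assms(2) by (auto simp: eventually_nhds)
  have "smooth_fun_on A (W \<inter> V) h"
    by (rule smooth_fun_on_cong[OF open_Int[OF W(1) V(1)] _ smooth_fun_on_subset[OF W(3)]])
      (use V in auto)
  then show ?thesis
    by (rule smooth_atI[OF _ open_Int[OF W(1) V(1)] IntI[OF W(2) V(2)]])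
qed

text \<open>Sums and products share the passage to a common neighbourhood and to charts; only the
  closure property of \<open>Ck_on\<close> differs.\<close>

lemma smooth_at_binary:
  assumes "C_at q f" "C_at q h"
    and "\<And>S k u v. open S \<Longrightarrow> Ck_on k S u \<Longrightarrow> Ck_on k S v \<Longrightarrow> Ck_on k (S :: (real^3) set) (\<lambda>x. F (u x) (v x))"
  shows "C_at q (\<lambda>x. F (f x) (h x))"
proof -
  obtain W where W: "open W" "q \<in> W" "smooth_fun_on A W f"
    using assms(1) by (auto simp: smooth_at_def)
  obtain V where V: "open V" "q \<in> V" "smooth_fun_on A V h"
    using assms(2) by (auto simp: smooth_at_def)
  have WV: "smooth_fun_on A (W \<inter> V) f" "smooth_fun_on A (W \<inter> V) h"
    using smooth_fun_on_subset[OF W(3)] smooth_fun_on_subset[OF V(3)] by auto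
  have "smooth_fun_on A (W \<inter> V) (\<lambda>x. F (f x) (h x))"
  proof (rule smooth_fun_onI)
    fix D \<phi> k assume c: "(D, \<phi>) \<in> A"
    show "Ck_on k (\<phi> ` (D \<inter> (W \<inter> V))) ((\<lambda>x. F (f x) (h x)) \<circ> inv_into D \<phi>)"
      using assms(3)[OF chart_facts(4)[OF c open_Int[OF W(1) V(1)]]
          smooth_fun_onD[OF WV(1) c] smooth_fun_onD[OF WV(2) c]]
      by (simp add: o_def)
  qed
  then show ?thesis
    by (rule smooth_atI[OF _ open_Int[OF W(1) V(1)] IntI[OF W(2) V(2)]])
qed

lemma smooth_at_const [simp]: "C_at q (\<lambda>_. c)"
proof -
  have "smooth_fun_on A UNIV (\<lambda>_. c)"
    by (rule smooth_fun_onI, unfold o_def, rule Ck_on_const[OF chart_facts(4)[OF _ open_UNIV]])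
  then show ?thesis
    unfolding smooth_at_def by blast
qed

lemma smooth_at_add: "C_at q f \<Longrightarrow> C_at q h \<Longrightarrow> C_at q (\<lambda>x. f x + h x)"
  by (rule smooth_at_binary) (auto intro: Ck_on_add)

lemma smooth_at_mult: "C_at q f \<Longrightarrow> C_at q h \<Longrightarrow> C_at q (\<lambda>x. f x * h x)"
  by (rule smooth_at_binary) (auto intro: Ck_on_mult)

lemma smooth_at_diff: "C_at q f \<Longrightarrow> C_at q h \<Longrightarrow> C_at q (\<lambda>x. f x - h x)"
  using smooth_at_add[of q f "\<lambda>x. (- 1) * h x"] smooth_at_mult[of q "\<lambda>_. - 1" h] by simp

lemma smooth_at_sum: "(\<And>i. i \<in> I \<Longrightarrow> C_at q (f i)) \<Longrightarrow> C_at q (\<lambda>x. \<Sum>i\<in>I. f i x)"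
  by (induction I rule: infinite_finite_induct) (auto intro: smooth_at_add)

lemma smooth_at_prod: "(\<And>i. i \<in> I \<Longrightarrow> C_at q (f i)) \<Longrightarrow> C_at q (\<lambda>x. \<Prod>i\<in>I. f i x)"
  by (induction I rule: infinite_finite_induct) (auto intro: smooth_at_mult)

lemma smooth_at_isCont:
  assumes "C_at q f"
  shows "isCont f q"
proof -
  obtain W where W: "open W" "q \<in> W" "smooth_fun_on A W f"
    using assms by (auto simp: smooth_at_def)
  obtain D \<phi> where c: "(D, \<phi>) \<in> A" "q \<in> D"
    by (rule chart_exists)
  have "Ck_on 0 (\<phi> ` (D \<inter> W)) (f \<circ> inv_into D \<phi>)"
    by (rule smooth_fun_onD[OF W(3) c(1)])
  then have "continuous_on (D \<inter> W) ((f \<circ> inv_into D \<phi>) \<circ> \<phi>)"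
    using chart_facts(3)[OF c(1)]
    by (intro continuous_on_compose[of _ \<phi>]) (auto intro: continuous_on_subset)
  then have "continuous_on (D \<inter> W) f"
    using chart_facts(2)[OF c(1)] by (subst continuous_on_cong[OF refl]) (auto simp: inv_into_f_f)
  then show ?thesis
    using W c chart_facts(1)[OF c(1)] by (simp add: continuous_on_eq_continuous_at open_Int)
qed

lemma smooth_at_eventually_nonzero:
  assumes "C_at q f" "f q \<noteq> 0"
  shows "\<forall>\<^sub>F r in nhds q. f r \<noteq> 0"
  using tendsto_imp_eventually_ne[OF smooth_at_isCont[OF assms(1), unfolded isCont_def] assms(2)] assms(2)
  by (simp add: eventually_nhds_conv_at)

lemma smooth_at_inverse:
  assumes "C_at q f" "f q \<noteq> 0"
  shows "C_at q (\<lambda>x. inverse (f x))"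
proof -
  obtain W where W: "open W" "q \<in> W" "smooth_fun_on A W f"
    using assms(1) by (auto simp: smooth_at_def)
  obtain V where V: "open V" "q \<in> V" "\<And>r. r \<in> V \<Longrightarrow> f r \<noteq> 0"
    using smooth_at_eventually_nonzero[OF assms] by (auto simp: eventually_nhds)
  have WV: "smooth_fun_on A (W \<inter> V) f"
    using smooth_fun_on_subset[OF W(3)] by auto
  have "smooth_fun_on A (W \<inter> V) (\<lambda>x. inverse (f x))"
  proof (rule smooth_fun_onI)
    fix D \<phi> k assume c: "(D, \<phi>) \<in> A"
    have "Ck_on k (\<phi> ` (D \<inter> (W \<inter> V))) (\<lambda>x. inverse ((f \<circ> inv_into D \<phi>) x))"
    proof (rule Ck_on_inverse)
      show "Ck_on k (\<phi> ` (D \<inter> (W \<inter> V))) (f \<circ> inv_into D \<phi>)"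
        by (rule smooth_fun_onD[OF WV c])
    qed (use chart_facts[OF c] W V in \<open>auto simp: inv_into_f_f\<close>)
    then show "Ck_on k (\<phi> ` (D \<inter> (W \<inter> V))) ((\<lambda>x. inverse (f x)) \<circ> inv_into D \<phi>)"
      by (simp add: o_def)
  qed
  then show ?thesis
    by (rule smooth_atI[OF _ open_Int[OF W(1) V(1)] IntI[OF W(2) V(2)]])
qed

text \<open>The Leibniz formula makes the determinant a polynomial in the entries.\<close>

lemma smooth_at_det:
  fixes M :: "'a \<Rightarrow> real^'n^'n"
  assumes "\<And>i j. C_at q (\<lambda>r. M r $ i $ j)"
  shows "C_at q (\<lambda>r. det (M r))"
  unfolding det_def by (intro smooth_at_sum smooth_at_mult smooth_at_prod smooth_at_const assms)

text \<open>By Cramer's rule the entries of the inverse are quotients of determinants, wherever the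
  determinant is nonzero, hence near q.\<close>

lemma smooth_at_matrix_inv:
  fixes M :: "'a \<Rightarrow> real^'n^'n"
  assumes "\<And>i j. C_at q (\<lambda>r. M r $ i $ j)" "det (M q) \<noteq> 0"
  shows "\<forall>\<^sub>F r in nhds q. det (M r) \<noteq> 0" "C_at q (\<lambda>r. matrix_inv (M r) $ i $ j)"
proof -
  show ev: "\<forall>\<^sub>F r in nhds q. det (M r) \<noteq> 0"
    by (rule smooth_at_eventually_nonzero[OF smooth_at_det]) (use assms in auto)
  \<comment> \<open>The numerator in Cramer's rule: column i of M is replaced by the j-th unit
    vector.\<close>
  define N where "N r = (\<chi> k l. if l = i then axis j 1 $ k else M r $ k $ l)" for r
  have N: "C_at q (\<lambda>r. N r $ k $ l)" for k l
    using assms(1) by (cases "l = i") (auto simp: N_def)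
  have "C_at q (\<lambda>r. det (N r) * inverse (det (M r)))"
    by (intro smooth_at_mult smooth_at_inverse smooth_at_det N assms)
  moreover have "\<forall>\<^sub>F r in nhds q. det (N r) * inverse (det (M r)) = matrix_inv (M r) $ i $ j"
    using ev
  proof eventually_elim
    case (elim r)
    then have "M r *v (matrix_inv (M r) *v axis j 1) = axis j 1"
      by (simp add: matrix_vector_mul_assoc matrix_inv_det_nz)
    then have "(matrix_inv (M r) *v axis j 1) $ i = det (N r) / det (M r)"
      using cramer[OF elim] by (simp add: N_def)
    then show ?case
      by (simp add: matrix_vector_mul_component inner_axis field_simps column_def
        matrix_vector_mult_basis)
  qed
  ultimately show "C_at q (\<lambda>r. matrix_inv (M r) $ i $ j)"
    by (rule smooth_at_cong)
qed

text \<open>Read in another chart, a coordinate is a component of a transition map.\<close>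

lemma smooth_at_coordinate:
  assumes "(D, \<phi>) \<in> A" "q \<in> D"
  shows "C_at q (\<lambda>x. \<phi> x $ i)"
proof -
  have "smooth_fun_on A D (\<lambda>x. \<phi> x $ i)"
  proof (rule smooth_fun_onI)
    fix E \<psi> k assume c: "(E, \<psi>) \<in> A"
    have "smooth_transition (E, \<psi>) (D, \<phi>)"
      using c assms(1) atlas by (auto simp: smooth_atlas_def)
    then have "Ck_on k (\<psi> ` (E \<inter> D)) (\<phi> \<circ> inv_into E \<psi>)"
      by (auto simp: smooth_transition_def smooth_map_on_def)
    then have "Ck_on k (\<psi> ` (E \<inter> D)) (\<lambda>x. (\<phi> \<circ> inv_into E \<psi>) x $ i)"
      by (rule Ck_on_bounded_linear[OF chart_facts(4)[OF c chart_facts(1)[OF assms(1)]]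
          bounded_linear_vec_nth])
    then show "Ck_on k (\<psi> ` (E \<inter> D)) ((\<lambda>x. \<phi> x $ i) \<circ> inv_into E \<psi>)"
      by (simp add: o_def)
  qed
  then show ?thesis
    using assms chart_facts(1)[OF assms(1)] smooth_atI by blast
qed

end

section \<open>Derivations, germs of vector fields and Lie brackets\<close>

section \<open>Tangent vectors and vector fields\<close>

lemma sum_apply: "(\<Sum>i\<in>I. (v i :: 'b \<Rightarrow> real)) f = (\<Sum>i\<in>I. v i f)"
  by (induction I rule: infinite_finite_induct) auto

lemma sum_scaleR_fun_apply: "(\<Sum>i\<in>I. c i *\<^sub>R (v i :: 'b \<Rightarrow> real)) f = (\<Sum>i\<in>I. c i * v i f)"
  by (simp add: sum_apply scaleR_fun_def)

context smooth_manifold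
begin

lemma tangent_spaceI:
  assumes "\<And>f h. C_at q f \<Longrightarrow> C_at q h \<Longrightarrow> v (\<lambda>x. f x + h x) = v f + v h"
    and "\<And>f h. C_at q f \<Longrightarrow> C_at q h \<Longrightarrow> v (\<lambda>x. f x * h x) = f q * v h + h q * v f"
    and "\<And>f c. C_at q f \<Longrightarrow> v (\<lambda>x. c * f x) = c * v f"
    and "\<And>f h. C_at q f \<Longrightarrow> C_at q h \<Longrightarrow> \<forall>\<^sub>F x in nhds q. f x = h x \<Longrightarrow> v f = v h"
    and "\<And>f. \<not> C_at q f \<Longrightarrow> v f = 0"
  shows "v \<in> T_at q"
  unfolding tangent_space_def using assms by blast

lemma tangent_space_props:
  assumes "v \<in> T_at q"
  shows tangent_add: "\<And>f h. C_at q f \<Longrightarrow> C_at q h \<Longrightarrow> v (\<lambda>x. f x + h x) = v f + v h"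
    and tangent_mult: "\<And>f h. C_at q f \<Longrightarrow> C_at q h \<Longrightarrow> v (\<lambda>x. f x * h x) = f q * v h + h q * v f"
    and tangent_cmult: "\<And>f c. C_at q f \<Longrightarrow> v (\<lambda>x. c * f x) = c * v f"
    and tangent_nonsmooth: "\<And>f. \<not> C_at q f \<Longrightarrow> v f = 0"
  using assms unfolding tangent_space_def by blast+

text \<open>Smoothness depends only on the germ, so either both functions are smooth at q or v is 0
  on both by the default value in \<open>tangent_space\<close>.\<close>

lemma tangent_cong:
  assumes "v \<in> T_at q" "\<forall>\<^sub>F x in nhds q. f x = h x"
  shows "v f = v h"
proof (cases "C_at q f")
  case True
  then show ?thesis
    using assms smooth_at_cong[OF True assms(2)] unfolding tangent_space_def by blast
next
  case False
  have "\<forall>\<^sub>F x in nhds q. h x = f x"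
    using assms(2) by eventually_elim simp
  then have "\<not> C_at q h"
    using False smooth_at_cong by blast
  then show ?thesis
    using False assms(1) by (simp add: tangent_nonsmooth)
qed

lemma tangent_const:
  assumes "v \<in> T_at q"
  shows "v (\<lambda>_. c) = 0"
  \<comment> \<open>The product rule for 1 = 1 * 1 says that the value at 1 is twice itself.\<close>
  using tangent_mult[OF assms, of "\<lambda>_. 1" "\<lambda>_. 1"] tangent_cmult[OF assms, of "\<lambda>_. 1" c] by simp

lemma tangent_diff:
  assumes "v \<in> T_at q" "C_at q f" "C_at q h"
  shows "v (\<lambda>x. f x - h x) = v f - v h"
  using tangent_add[OF assms(1,2), of "\<lambda>x. (- 1) * h x"] tangent_cmult[OF assms(1,3), of "- 1"]
    smooth_at_mult[OF smooth_at_const assms(3), of "- 1"] by simp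

lemma tangent_sum:
  assumes "v \<in> T_at q" "\<And>i. i \<in> I \<Longrightarrow> C_at q (f i)"
  shows "v (\<lambda>x. \<Sum>i\<in>I. f i x) = (\<Sum>i\<in>I. v (f i))"
  using assms(2)
proof (induction I rule: infinite_finite_induct)
  case (insert i I)
  then show ?case
    using tangent_add[OF assms(1), of "f i" "\<lambda>x. \<Sum>i\<in>I. f i x"] by (simp add: smooth_at_sum)
qed (use tangent_const[OF assms(1)] in auto)

lemma subspace_tangent: "subspace (T_at q)"
proof (rule subspaceI)
  show "0 \<in> T_at q"
    by (rule tangent_spaceI) auto
next
  fix v w assume v: "v \<in> T_at q" and w: "w \<in> T_at q"
  show "v + w \<in> T_at q"
    by (rule tangent_spaceI)
      (auto simp: tangent_space_props[OF v] tangent_space_props[OF w] tangent_const[OF v]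
        tangent_const[OF w] algebra_simps intro!: arg_cong2[of _ _ _ _ "(+)"]
        intro: tangent_cong[OF v] tangent_cong[OF w])
next
  fix c v assume v: "v \<in> T_at q"
  show "c *\<^sub>R v \<in> T_at q"
    by (rule tangent_spaceI)
      (auto simp: tangent_space_props[OF v] tangent_const[OF v] scaleR_fun_def algebra_simps
        intro: tangent_cong[OF v])
qed

text \<open>The germ version of \<open>smooth_vfield_on\<close>. Asking for the conditions at all
  nearby points makes the notion persist near q, as iterated derivatives require.\<close>

definition vf_at :: "'a \<Rightarrow> 'a vfield \<Rightarrow> bool" where
  "vf_at q X \<longleftrightarrow> (\<forall>\<^sub>F r in nhds q. X r \<in> T_at r \<and> (\<forall>f. C_at r f \<longrightarrow> C_at r (\<lambda>s. X s f)))"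

lemma vf_at_tangent: "vf_at q X \<Longrightarrow> X q \<in> T_at q"
  unfolding vf_at_def by (drule eventually_nhds_x_imp_x) blast

lemma vf_at_smooth: "vf_at q X \<Longrightarrow> C_at q f \<Longrightarrow> C_at q (\<lambda>s. X s f)"
  unfolding vf_at_def by (drule eventually_nhds_x_imp_x) blast

lemma vf_at_eventually: "vf_at q X \<Longrightarrow> \<forall>\<^sub>F r in nhds q. vf_at r X"
  unfolding vf_at_def by (simp add: eventually_eventually)

lemma vf_at_eventually_tangent: "vf_at q X \<Longrightarrow> \<forall>\<^sub>F r in nhds q. X r \<in> T_at r"
  unfolding vf_at_def by (erule eventually_mono) blast

lemma smooth_vfield_on_iff:
  assumes "open U"
  shows "smooth_vfield_on A U X \<longleftrightarrow> (\<forall>q\<in>U. vf_at q X)"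
proof
  assume X: "smooth_vfield_on A U X"
  have "X q \<in> T_at q \<and> (\<forall>f. C_at q f \<longrightarrow> C_at q (\<lambda>s. X s f))" if q: "q \<in> U" for q
  proof safe
    show "X q \<in> T_at q"
      using X q by (simp add: smooth_vfield_on_def)
    fix f assume "C_at q f"
    then obtain W where W: "open W" "q \<in> W" "smooth_fun_on A W f"
      unfolding smooth_at_def by blast
    have "smooth_fun_on A (W \<inter> U) f"
      using smooth_fun_on_subset[OF W(3)] by simp
    then have "smooth_fun_on A (W \<inter> U) (\<lambda>s. X s f)"
      using X open_Int[OF W(1) assms] unfolding smooth_vfield_on_def by blast
    then show "C_at q (\<lambda>s. X s f)"
      by (rule smooth_atI[OF _ open_Int[OF W(1) assms] IntI[OF W(2) q]])
  qed
  then show "\<forall>q\<in>U. vf_at q X"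
    using assms unfolding vf_at_def eventually_nhds by blast
next
  assume X: "\<forall>q\<in>U. vf_at q X"
  show "smooth_vfield_on A U X"
    unfolding smooth_vfield_on_def
  proof safe
    show "X q \<in> T_at q" if "q \<in> U" for q
      using X that vf_at_tangent by blast
    fix W f assume W: "open W" "W \<subseteq> U" "smooth_fun_on A W f"
    then show "smooth_fun_on A W (\<lambda>s. X s f)"
      using X vf_at_smooth unfolding smooth_fun_on_iff[OF W(1)] by blast
  qed
qed

text \<open>The equality holds near q and not just at q, so it can be differentiated again; the
  other \<open>lie_\<close> rules have this form for the same reason.\<close>

lemma lie_cong:
  assumes "vf_at q X" "\<forall>\<^sub>F r in nhds q. f r = h r"
  shows "\<forall>\<^sub>F r in nhds q. X r f = X r h"
proof -
  have "\<forall>\<^sub>F r in nhds q. \<forall>\<^sub>F s in nhds r. f s = h s"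
    using assms(2) by (simp add: eventually_eventually)
  with vf_at_eventually_tangent[OF assms(1)] show ?thesis
    by eventually_elim (rule tangent_cong)
qed

lemma lie_diff:
  assumes "vf_at q X" "C_at q f" "C_at q h"
  shows "\<forall>\<^sub>F r in nhds q. X r (\<lambda>x. f x - h x) = X r f - X r h"
  using vf_at_eventually_tangent[OF assms(1)] assms(2,3)[THEN smooth_at_eventually]
  by eventually_elim (rule tangent_diff)

lemma lie_add:
  assumes "vf_at q X" "C_at q f" "C_at q h"
  shows "\<forall>\<^sub>F r in nhds q. X r (\<lambda>x. f x + h x) = X r f + X r h"
  using vf_at_eventually_tangent[OF assms(1)] assms(2,3)[THEN smooth_at_eventually]
  by eventually_elim (rule tangent_add)

lemma lie_mult:
  assumes "vf_at q X" "C_at q f" "C_at q h"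
  shows "\<forall>\<^sub>F r in nhds q. X r (\<lambda>x. f x * h x) = f r * X r h + h r * X r f"
  using vf_at_eventually_tangent[OF assms(1)] assms(2,3)[THEN smooth_at_eventually]
  by eventually_elim (rule tangent_mult)

lemma lie_cmult:
  assumes "vf_at q X" "C_at q f"
  shows "\<forall>\<^sub>F r in nhds q. X r (\<lambda>x. c * f x) = c * X r f"
  using vf_at_eventually_tangent[OF assms(1)] assms(2)[THEN smooth_at_eventually]
  by eventually_elim (rule tangent_cmult)

lemma vf_at_sum_scaleR:
  assumes "\<And>i. i \<in> I \<Longrightarrow> C_at q (a i)" "\<And>i. i \<in> I \<Longrightarrow> vf_at q (X i)" "finite I"
  shows "vf_at q (\<lambda>r. \<Sum>i\<in>I. a i r *\<^sub>R X i r)"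
proof -
  have "\<forall>\<^sub>F r in nhds q. \<forall>i\<in>I. C_at r (a i) \<and> vf_at r (X i)"
    by (intro eventually_ball_finite ballI eventually_conj smooth_at_eventually vf_at_eventually assms)
  then show ?thesis
    unfolding vf_at_def[of q "\<lambda>r. \<Sum>i\<in>I. a i r *\<^sub>R X i r"]
  proof eventually_elim
    case (elim r)
    have "(\<Sum>i\<in>I. a i r *\<^sub>R X i r) \<in> T_at r"
      using elim vf_at_tangent by (intro subspace_sum subspace_tangent subspace_scale) auto
    moreover have "C_at r (\<lambda>s. (\<Sum>i\<in>I. a i s *\<^sub>R X i s) f)" if "C_at r f" for f
      unfolding sum_scaleR_fun_apply using elim vf_at_smooth[OF _ that]
      by (intro smooth_at_sum smooth_at_mult) auto
    ultimately show ?case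
      by blast
  qed
qed

lemma bracket_apply: "C_at q f \<Longrightarrow> bracket A X Y q f = X q (\<lambda>r. Y r f) - Y q (\<lambda>r. X r f)"
  by (simp add: bracket_def)

lemma bracket_tangent:
  assumes X: "vf_at q X" and Y: "vf_at q Y"
  shows "bracket A X Y q \<in> T_at q"
proof (rule tangent_spaceI)
  note tX = vf_at_tangent[OF X] and tY = vf_at_tangent[OF Y]
  note sX = vf_at_smooth[OF X] and sY = vf_at_smooth[OF Y]
  fix f assume f: "C_at q f"
  {
    fix h assume h: "C_at q h"
    have "X q (\<lambda>r. Y r (\<lambda>x. f x + h x)) = X q (\<lambda>r. Y r f) + X q (\<lambda>r. Y r h)"
      using tangent_cong[OF tX lie_add[OF Y f h]] tangent_add[OF tX sY sY] f h by simp
    moreover have "Y q (\<lambda>r. X r (\<lambda>x. f x + h x)) = Y q (\<lambda>r. X r f) + Y q (\<lambda>r. X r h)"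
      using tangent_cong[OF tY lie_add[OF X f h]] tangent_add[OF tY sX sX] f h by simp
    ultimately show "bracket A X Y q (\<lambda>x. f x + h x) = bracket A X Y q f + bracket A X Y q h"
      using f h smooth_at_add by (simp add: bracket_apply)
    \<comment> \<open>In the two expansions below, the products of first derivatives are the same
      and cancel in the bracket, leaving the product rule.\<close>
    have "X q (\<lambda>r. Y r (\<lambda>x. f x * h x)) =
        (f q * X q (\<lambda>r. Y r h) + Y q h * X q f) + (h q * X q (\<lambda>r. Y r f) + Y q f * X q h)"
      using tangent_cong[OF tX lie_mult[OF Y f h]] f h
      by (simp add: tangent_add[OF tX] tangent_mult[OF tX] smooth_at_mult sY)
    moreover have "Y q (\<lambda>r. X r (\<lambda>x. f x * h x)) =
        (f q * Y q (\<lambda>r. X r h) + X q h * Y q f) + (h q * Y q (\<lambda>r. X r f) + X q f * Y q h)"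
      using tangent_cong[OF tY lie_mult[OF X f h]] f h
      by (simp add: tangent_add[OF tY] tangent_mult[OF tY] smooth_at_mult sX)
    ultimately show "bracket A X Y q (\<lambda>x. f x * h x) = f q * bracket A X Y q h + h q * bracket A X Y q f"
      using f h smooth_at_mult by (simp add: bracket_apply algebra_simps)
    assume "\<forall>\<^sub>F x in nhds q. f x = h x"
    then show "bracket A X Y q f = bracket A X Y q h"
      using f h tangent_cong[OF tX lie_cong[OF Y]] tangent_cong[OF tY lie_cong[OF X]]
      by (simp add: bracket_apply)
  }
  fix c
  show "bracket A X Y q (\<lambda>x. c * f x) = c * bracket A X Y q f"
    using f tangent_cong[OF tX lie_cmult[OF Y f]] tangent_cong[OF tY lie_cmult[OF X f]]
    by (simp add: bracket_apply smooth_at_mult tangent_cmult[OF tX] tangent_cmult[OF tY]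
        sX sY algebra_simps)
qed (simp add: bracket_def)

lemma lie_bracket:
  assumes "C_at q f"
  shows "\<forall>\<^sub>F r in nhds q. bracket A X Y r f = X r (\<lambda>s. Y s f) - Y r (\<lambda>s. X s f)"
  using smooth_at_eventually[OF assms] by eventually_elim (rule bracket_apply)

lemma vf_at_bracket:
  assumes "vf_at q X" "vf_at q Y"
  shows "vf_at q (bracket A X Y)"
  unfolding vf_at_def using assms[THEN vf_at_eventually]
proof eventually_elim
  case (elim r)
  have "C_at r (\<lambda>s. bracket A X Y s f)" if f: "C_at r f" for f
  proof (rule smooth_at_cong)
    show "C_at r (\<lambda>s. X s (\<lambda>t. Y t f) - Y s (\<lambda>t. X t f))"
      by (rule smooth_at_diff; rule vf_at_smooth, rule elim, rule vf_at_smooth, rule elim, rule f)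
    show "\<forall>\<^sub>F s in nhds r. X s (\<lambda>t. Y t f) - Y s (\<lambda>t. X t f) = bracket A X Y s f"
      using lie_bracket[OF f, of X Y] by (rule eventually_mono) simp
  qed
  then show ?case
    using bracket_tangent[OF elim] by blast
qed

text \<open>Product rule for the bracket of two combinations of the fields \<open>X i\<close>: the
  first sum collects the derivatives of the coefficients, the second the brackets of the fields
  themselves. The expansions are assumed near q because the bracket differentiates them.\<close>

lemma bracket_sum_scaleR:
  assumes X: "\<And>i. i \<in> I \<Longrightarrow> vf_at q (X i)" and "finite I"
    and Y: "vf_at q Y" and a: "\<And>i. i \<in> I \<Longrightarrow> C_at q (a i)"
    and Ya: "\<forall>\<^sub>F r in nhds q. Y r = (\<Sum>i\<in>I. a i r *\<^sub>R X i r)"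
    and Z: "vf_at q Z" and b: "\<And>i. i \<in> I \<Longrightarrow> C_at q (b i)"
    and Zb: "\<forall>\<^sub>F r in nhds q. Z r = (\<Sum>i\<in>I. b i r *\<^sub>R X i r)"
  shows "bracket A Y Z q = (\<Sum>i\<in>I. (Y q (b i) - Z q (a i)) *\<^sub>R X i q)
    + (\<Sum>i\<in>I. \<Sum>j\<in>I. (a i q * b j q) *\<^sub>R bracket A (X i) (X j) q)"
    (is "_ = ?R")
proof
  fix f
  have R: "?R f = (\<Sum>i\<in>I. (Y q (b i) - Z q (a i)) * X i q f)
      + (\<Sum>i\<in>I. \<Sum>j\<in>I. a i q * b j q * bracket A (X i) (X j) q f)"
    unfolding plus_fun_apply sum_apply scaleR_fun_def by simp
  show "bracket A Y Z q f = ?R f"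
  proof (cases "C_at q f")
    case True
    have 1: "V q (\<lambda>r. W r f) = (\<Sum>i\<in>I. V q (c i) * X i q f + c i q * V q (\<lambda>r. X i r f))"
      if V: "vf_at q V" and c: "\<And>i. i \<in> I \<Longrightarrow> C_at q (c i)"
        and W: "\<forall>\<^sub>F r in nhds q. W r = (\<Sum>i\<in>I. c i r *\<^sub>R X i r)" for V W c
    proof -
      have "\<forall>\<^sub>F r in nhds q. W r f = (\<Sum>i\<in>I. c i r * X i r f)"
        using W by eventually_elim (simp add: sum_scaleR_fun_apply)
      then have "V q (\<lambda>r. W r f) = V q (\<lambda>r. \<Sum>i\<in>I. c i r * X i r f)"
        by (rule tangent_cong[OF vf_at_tangent[OF V]])
      also have "\<dots> = (\<Sum>i\<in>I. V q (\<lambda>r. c i r * X i r f))"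
        by (rule tangent_sum[OF vf_at_tangent[OF V] smooth_at_mult[OF c vf_at_smooth[OF X True]]])
      also have "\<dots> = (\<Sum>i\<in>I. V q (c i) * X i q f + c i q * V q (\<lambda>r. X i r f))"
        using c X True by (intro sum.cong refl)
          (simp add: tangent_mult[OF vf_at_tangent[OF V]] vf_at_smooth)
      finally show ?thesis .
    qed
    \<comment> \<open>The outer field is only evaluated at q, so its expansion is needed at that
      point alone.\<close>
    have 2: "Y q h = (\<Sum>i\<in>I. a i q * X i q h)" "Z q h = (\<Sum>i\<in>I. b i q * X i q h)" for h
      using eventually_nhds_x_imp_x[OF Ya] eventually_nhds_x_imp_x[OF Zb]
      by (simp_all add: sum_scaleR_fun_apply)
    have "(\<Sum>i\<in>I. b i q * Y q (\<lambda>r. X i r f)) = (\<Sum>i\<in>I. \<Sum>j\<in>I. a i q * b j q * X i q (\<lambda>r. X j r f))"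
      unfolding 2 sum_distrib_left by (subst sum.swap) (simp add: ac_simps)
    moreover have "(\<Sum>i\<in>I. a i q * Z q (\<lambda>r. X i r f)) = (\<Sum>i\<in>I. \<Sum>j\<in>I. a i q * b j q * X j q (\<lambda>r. X i r f))"
      unfolding 2 sum_distrib_left by (simp add: ac_simps)
    moreover have "Y q (\<lambda>r. Z r f) = (\<Sum>i\<in>I. Y q (b i) * X i q f + b i q * Y q (\<lambda>r. X i r f))"
      by (rule 1[OF Y _ Zb]) (rule b)
    moreover have "Z q (\<lambda>r. Y r f) = (\<Sum>i\<in>I. Z q (a i) * X i q f + a i q * Z q (\<lambda>r. X i r f))"
      by (rule 1[OF Z _ Ya]) (rule a)
    ultimately show ?thesis
      unfolding R bracket_apply[OF True]
      by (simp add: sum.distrib sum_subtractf algebra_simps)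
  next
    case False
    \<comment> \<open>On functions that are not smooth at q both sides take the default value
      0.\<close>
    then have "X i q f = 0" if "i \<in> I" for i
      using X[OF that] vf_at_tangent tangent_nonsmooth by blast
    then show ?thesis
      unfolding R using False by (simp add: bracket_def)
  qed
qed

end

section \<open>Dual functions, and why an orthonormal frame with its bracket spans\<close>

section \<open>Bracket-generating frames\<close>

text \<open>The combinations with coefficients indexed by the type form a subspace containing every
  \<open>w i\<close>. Indexing by the type, not by the set \<open>range w\<close>, allows repeated
  vectors.\<close>

lemma span_range_finite:
  fixes w :: "'n::finite \<Rightarrow> 'v::real_vector"
  assumes "v \<in> span (range w)"
  obtains c where "v = (\<Sum>i\<in>UNIV. c i *\<^sub>R w i)"
proof -
  have "subspace (range (\<lambda>c. \<Sum>i\<in>UNIV. c i *\<^sub>R w i))"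
  proof (rule subspaceI)
    show "0 \<in> range (\<lambda>c. \<Sum>i\<in>UNIV. c i *\<^sub>R w i)"
      by (rule range_eqI[of _ _ "\<lambda>_. 0"]) simp
  next
    fix x y assume "x \<in> range (\<lambda>c. \<Sum>i\<in>UNIV. c i *\<^sub>R w i)" "y \<in> range (\<lambda>c. \<Sum>i\<in>UNIV. c i *\<^sub>R w i)"
    then obtain c d where "x = (\<Sum>i\<in>UNIV. c i *\<^sub>R w i)" "y = (\<Sum>i\<in>UNIV. d i *\<^sub>R w i)"
      by blast
    then show "x + y \<in> range (\<lambda>c. \<Sum>i\<in>UNIV. c i *\<^sub>R w i)"
      by (intro range_eqI[of _ _ "\<lambda>i. c i + d i"]) (simp add: scaleR_add_left sum.distrib)
  next
    fix a x assume "x \<in> range (\<lambda>c. \<Sum>i\<in>UNIV. c i *\<^sub>R w i)"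
    then obtain c where "x = (\<Sum>i\<in>UNIV. c i *\<^sub>R w i)"
      by blast
    then show "a *\<^sub>R x \<in> range (\<lambda>c. \<Sum>i\<in>UNIV. c i *\<^sub>R w i)"
      by (intro range_eqI[of _ _ "\<lambda>i. a * c i"]) (simp add: scaleR_sum_right)
  qed
  moreover have "range w \<subseteq> range (\<lambda>c. \<Sum>i\<in>UNIV. c i *\<^sub>R w i)"
  proof safe
    fix i
    have "w i = (\<Sum>k\<in>UNIV. (if k = i then 1 else 0) *\<^sub>R w k)"
      by (simp add: if_distrib[where f = "\<lambda>x. x *\<^sub>R _"] cong: if_cong)
    then show "w i \<in> range (\<lambda>c. \<Sum>i\<in>UNIV. c i *\<^sub>R w i)"
      by (rule range_eqI[where x = "\<lambda>k. if k = i then 1 else 0"])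
  qed
  ultimately show ?thesis
    using assms that span_minimal by blast
qed

context smooth_manifold
begin

text \<open>These are the coordinates of a chart and its partial derivatives, transported to
  q.\<close>

lemma coordinate_derivations:
  obtains x :: "3 \<Rightarrow> 'a \<Rightarrow> real" and d :: "3 \<Rightarrow> 'a tvec"
  where "\<And>i. C_at q (x i)" "\<And>i. d i \<in> T_at q" "\<And>i j. d i (x j) = (if i = j then 1 else 0)"
proof -
  obtain D \<phi> where c: "(D, \<phi>) \<in> A" "q \<in> D"
    using chart_exists[of q] by metis
  define p where "p f = f \<circ> inv_into D \<phi>" for f :: "'a \<Rightarrow> real"
  have inv: "inv_into D \<phi> (\<phi> q) = q"
    using chart_facts(2)[OF c(1)] c(2) by simp
  have der: "(p f has_derivative frechet_derivative (p f) (at (\<phi> q))) (at (\<phi> q))"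
    if f: "C_at q f" for f
  proof -
    obtain W where W: "open W" "q \<in> W" "smooth_fun_on A W f"
      using f unfolding smooth_at_def by metis
    show ?thesis
      unfolding p_def
      by (rule Ck_on_Suc_has_derivative[OF chart_facts(4)[OF c(1) W(1)] smooth_fun_onD[OF W(3) c(1)]])
        (use c W in blast)
  qed
  \<comment> \<open>The value 0 on functions not smooth at q is the convention of
    \<open>tangent_space\<close>.\<close>
  define d where "d i f = (if C_at q f then frechet_derivative (p f) (at (\<phi> q)) (axis i 1) else 0)"
    for i :: 3 and f
  have dI: "d i f = F (axis i 1)" if "C_at q f" "(p f has_derivative F) (at (\<phi> q))" for i f F
    using that frechet_derivative_at by (force simp: d_def)
  define x where "x i r = \<phi> r $ i" for i :: 3 and r
  have x: "C_at q (x i)" for i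
    unfolding x_def by (rule smooth_at_coordinate[OF c])
  moreover have "d i \<in> T_at q" for i
  proof (rule tangent_spaceI)
    fix f assume f: "C_at q f"
    {
      fix h assume h: "C_at q h"
      have "(p (\<lambda>x. f x + h x) has_derivative
          (\<lambda>b. frechet_derivative (p f) (at (\<phi> q)) b + frechet_derivative (p h) (at (\<phi> q)) b)) (at (\<phi> q))"
        using has_derivative_add[OF der[OF f] der[OF h]] by (simp add: p_def o_def)
      from dI[OF smooth_at_add[OF f h] this]
      show "d i (\<lambda>x. f x + h x) = d i f + d i h"
        using f h by (simp add: d_def)
      have "(p (\<lambda>x. f x * h x) has_derivative
          (\<lambda>b. f q * frechet_derivative (p h) (at (\<phi> q)) b + frechet_derivative (p f) (at (\<phi> q)) b * h q)) (at (\<phi> q))"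
        using has_derivative_mult[OF der[OF f] der[OF h]] by (simp add: p_def o_def inv)
      from dI[OF smooth_at_mult[OF f h] this]
      show "d i (\<lambda>x. f x * h x) = f q * d i h + h q * d i f"
        using f h by (simp add: d_def)
      assume "\<forall>\<^sub>F x in nhds q. f x = h x"
      then obtain W where W: "open W" "q \<in> W" "\<And>x. x \<in> W \<Longrightarrow> f x = h x"
        by (auto simp: eventually_nhds)
      have "frechet_derivative (p f) (at (\<phi> q)) = frechet_derivative (p h) (at (\<phi> q))"
        by (rule frechet_derivative_cong_open[OF chart_facts(4)[OF c(1) W(1)]])
          (use c W chart_facts(2)[OF c(1)] in \<open>auto simp: p_def\<close>)
      then show "d i f = d i h"
        using f h by (simp add: d_def)
    }
    fix a
    have "(p (\<lambda>x. a * f x) has_derivative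
        (\<lambda>b. a * frechet_derivative (p f) (at (\<phi> q)) b)) (at (\<phi> q))"
      using has_derivative_mult_right[OF der[OF f]] by (simp add: p_def o_def)
    from dI[OF smooth_at_mult[OF smooth_at_const f] this]
    show "d i (\<lambda>x. a * f x) = a * d i f"
      using f by (simp add: d_def)
  qed (simp add: d_def)
  moreover have "d i (x j) = (if i = j then 1 else 0)" for i j
  proof -
    have "((\<lambda>v. v $ j) has_derivative (\<lambda>v. v $ j)) (at (\<phi> q))"
      by (rule bounded_linear_imp_has_derivative[OF bounded_linear_vec_nth])
    then have "(p (x j) has_derivative (\<lambda>v. v $ j)) (at (\<phi> q))"
    proof (rule has_derivative_transform_within_open)
      show "open (\<phi> ` (D \<inter> UNIV))"
        by (rule chart_facts(4)[OF c(1) open_UNIV])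
    qed (use c in \<open>auto simp: p_def x_def f_inv_into_f\<close>)
    from dI[OF x this] show ?thesis
      by (simp add: axis_def)
  qed
  ultimately show thesis
    by (rule that)
qed

text \<open>Expanding the partial derivatives of a chart in the vectors \<open>v k\<close> shows
  that the matrix \<open>v k (x j)\<close> is invertible. Its inverse gives the linear change of
  coordinates that makes them dual to v.\<close>

lemma dual_functions:
  fixes v :: "3 \<Rightarrow> 'a tvec"
  assumes "span (range v) = T_at q"
  obtains y where "\<And>i. C_at q (y i)" "\<And>i. y i q = 0" "\<And>i j. v i (y j) = (if i = j then 1 else 0)"
proof -
  have v: "v i \<in> T_at q" for i
    using assms by (metis rangeI span_base)
  obtain x :: "3 \<Rightarrow> 'a \<Rightarrow> real" and d where x: "\<And>i. C_at q (x i)" and d: "\<And>i. d i \<in> T_at q"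
    and dx: "\<And>i j. d i (x j) = (if i = j then 1 else 0)"
    by (rule coordinate_derivations[of q]) (rule that)
  have "\<exists>c. d i = (\<Sum>k\<in>UNIV. c k *\<^sub>R v k)" for i
    using span_range_finite[of "d i" v] d assms by metis
  then obtain M where M: "\<And>i. d i = (\<Sum>k\<in>UNIV. M i k *\<^sub>R v k)"
    by metis
  have "(\<chi> i k. M i k) ** (\<chi> k j. v k (x j)) = mat 1"
    using dx unfolding M sum_scaleR_fun_apply
    by (simp add: matrix_matrix_mult_def mat_def vec_eq_iff)
  \<comment> \<open>For square matrices a left inverse is also a right inverse.\<close>
  then have "(\<chi> k j. v k (x j)) ** (\<chi> i k. M i k) = mat 1"
    by (rule matrix_left_right_inverse1)
  then have vM: "(\<Sum>k\<in>UNIV. v i (x k) * M k j) = (if i = j then 1 else 0)" for i j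
    by (simp add: matrix_matrix_mult_def mat_def vec_eq_iff)
  \<comment> \<open>Subtracting the values at q centres the new coordinates there.\<close>
  define y where "y j r = (\<Sum>k\<in>UNIV. M k j * (x k r - x k q))" for j r
  have s: "C_at q (\<lambda>r. x k r - x k q)" for k
    by (rule smooth_at_diff[OF x smooth_at_const])
  show thesis
  proof (rule that)
    show "C_at q (y j)" for j
      unfolding y_def by (rule smooth_at_sum[OF smooth_at_mult[OF smooth_at_const s]])
    show "y j q = 0" for j
      by (simp add: y_def)
    show "v i (y j) = (if i = j then 1 else 0)" for i j
      using vM[of i j] unfolding y_def
      by (simp add: tangent_sum[OF v smooth_at_mult[OF smooth_at_const s]] tangent_cmult[OF v s]
          tangent_diff[OF v x smooth_at_const] tangent_const[OF v] mult.commute)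
  qed
qed

lemma orthonormal_frame_vf_at:
  assumes "open U" "orthonormal_frame A H ip U X1 X2" "q \<in> U"
  shows "vf_at q X1" "vf_at q X2"
  using assms unfolding orthonormal_frame_def frame_on_def smooth_section_on_def
  by (auto simp: smooth_vfield_on_iff)

text \<open>The expansion of a vector in an orthonormal basis; its coefficients are smooth because
  the fiber inner product is.\<close>

lemma section_coefficients:
  assumes ip: "smooth_fiber_inner_product A H ip"
    and U: "open U" "q \<in> U" and X: "orthonormal_frame A H ip U X1 X2"
    and W: "open W" "q \<in> W" and Y: "smooth_section_on A W H Y"
  shows "C_at q (\<lambda>r. ip r (Y r) (X1 r))" "C_at q (\<lambda>r. ip r (Y r) (X2 r))"
    "\<forall>\<^sub>F r in nhds q. Y r = ip r (Y r) (X1 r) *\<^sub>R X1 r + ip r (Y r) (X2 r) *\<^sub>R X2 r"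
proof -
  have V: "open (W \<inter> U)" "q \<in> W \<inter> U"
    using U W by auto
  have restrict: "smooth_section_on A (W \<inter> U) H Z"
    if "smooth_section_on A W H Z \<or> smooth_section_on A U H Z" for Z
    using that V(1) U W by (auto simp: smooth_section_on_def smooth_vfield_on_iff)
  have sec: "smooth_section_on A U H X1" "smooth_section_on A U H X2"
    using X by (auto simp: orthonormal_frame_def frame_on_def)
  have "smooth_fun_on A (W \<inter> U) (\<lambda>r. ip r (Y r) (X1 r))" "smooth_fun_on A (W \<inter> U) (\<lambda>r. ip r (Y r) (X2 r))"
    using ip restrict Y sec V(1) unfolding smooth_fiber_inner_product_def by blast+
  then show "C_at q (\<lambda>r. ip r (Y r) (X1 r))" "C_at q (\<lambda>r. ip r (Y r) (X2 r))"
    using V smooth_atI by blast+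
  have "Y r = ip r (Y r) (X1 r) *\<^sub>R X1 r + ip r (Y r) (X2 r) *\<^sub>R X2 r" if r: "r \<in> W \<inter> U" for r
  proof -
    have H: "span {X1 r, X2 r} = H r" and on: "ip r (X1 r) (X1 r) = 1" "ip r (X2 r) (X2 r) = 1" "ip r (X1 r) (X2 r) = 0"
      using X r by (auto simp: orthonormal_frame_def frame_on_def)
    have mem: "X1 r \<in> H r" "X2 r \<in> H r" "a *\<^sub>R X1 r \<in> H r" "a *\<^sub>R X2 r \<in> H r" for a
      unfolding H[symmetric] by (auto intro: span_base span_scale)
    have I: "inner_product_on (H r) (ip r)"
      using ip by (simp add: smooth_fiber_inner_product_def)
    have sym: "ip r (X2 r) (X1 r) = 0"
      using I mem on unfolding inner_product_on_def by metis
    have "Y r \<in> span {X1 r, X2 r}"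
      using Y r unfolding H smooth_section_on_def by blast
    then obtain a b where "Y r = a *\<^sub>R X1 r + b *\<^sub>R X2 r"
      by (auto simp: span_breakdown_eq algebra_simps)
    moreover have "ip r (a *\<^sub>R X1 r + b *\<^sub>R X2 r) v = a * ip r (X1 r) v + b * ip r (X2 r) v" if "v \<in> H r" for v
    proof -
      have "ip r (x + y) v = ip r x v + ip r y v" "ip r (c *\<^sub>R x) v = c * ip r x v"
        if "x \<in> H r" "y \<in> H r" for c x y
        using I[unfolded inner_product_on_def, THEN conjunct2] that \<open>v \<in> H r\<close> by simp_all
      then show ?thesis
        using mem by simp
    qed
    ultimately show ?thesis
      using on sym mem by simp
  qed
  then show "\<forall>\<^sub>F r in nhds q. Y r = ip r (Y r) (X1 r) *\<^sub>R X1 r + ip r (Y r) (X2 r) *\<^sub>R X2 r"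
    using V unfolding eventually_nhds by blast
qed

lemma bracket_self: "bracket A X X q = 0"
  by (simp add: bracket_def fun_eq_iff)

lemma bracket_swap: "bracket A X Y q = - bracket A Y X q"
  by (simp add: bracket_def fun_eq_iff)

text \<open>The bracket-generating condition allows all local sections. Expanded in the frame, the
  bracket of two sections is a combination of \<open>X1\<close>, \<open>X2\<close> and their
  bracket, so these three already span.\<close>

lemma span_frame_bracket:
  assumes sr: "sub_riemannian_23 A H ip" and U: "open U" "q \<in> U"
    and X: "orthonormal_frame A H ip U X1 X2"
  shows "span {X1 q, X2 q, bracket A X1 X2 q} = T_at q"
proof
  note vf = orthonormal_frame_vf_at[OF U(1) X U(2)]
  show "span {X1 q, X2 q, bracket A X1 X2 q} \<subseteq> T_at q"
    using vf_at_tangent vf vf_at_bracket by (intro span_minimal subspace_tangent) auto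
  let ?S = "span {X1 q, X2 q, bracket A X1 X2 q}"
  have S: "X1 q \<in> ?S" "X2 q \<in> ?S" "bracket A X1 X2 q \<in> ?S"
    by (auto intro: span_base)
  have "H q = span {X1 q, X2 q}"
    using X U(2) by (simp add: orthonormal_frame_def frame_on_def)
  then have "H q \<subseteq> ?S"
    by (simp add: span_mono)
  moreover have "bracket A Y Z q \<in> ?S"
    if W: "open W" "q \<in> W" "smooth_section_on A W H Y" "smooth_section_on A W H Z" for W Y Z
  proof -
    have ip: "smooth_fiber_inner_product A H ip"
      using sr by (simp add: sub_riemannian_23_def)
    note Y = section_coefficients[OF ip U X W(1,2,3)] and Z = section_coefficients[OF ip U X W(1,2,4)]
    have YZ: "vf_at q Y" "vf_at q Z"
      using W by (auto simp: smooth_section_on_def smooth_vfield_on_iff)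
    \<comment> \<open>The type bool serves as an index type with two elements.\<close>
    define V where "V b = (if b then X1 else X2)" for b
    have "bracket A Y Z q = (\<Sum>i\<in>UNIV. (Y q (\<lambda>r. ip r (Z r) (V i r)) - Z q (\<lambda>r. ip r (Y r) (V i r))) *\<^sub>R V i q)
        + (\<Sum>i\<in>UNIV. \<Sum>j\<in>UNIV. (ip q (Y q) (V i q) * ip q (Z q) (V j q)) *\<^sub>R bracket A (V i) (V j) q)"
      using YZ Y Z vf by (intro bracket_sum_scaleR) (auto simp: V_def UNIV_bool add.commute)
    also have "\<dots> \<in> ?S"
      by (intro span_add span_sum span_scale)
        (use S span_neg[OF S(3)] in \<open>auto simp: V_def bracket_self bracket_swap[of X2] span_zero\<close>)
    finally show ?thesis .
  qed
  ultimately have "span (H q \<union> {bracket A X Y q | X Y. \<exists>W. open W \<and> q \<in> W \<and>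
      smooth_section_on A W H X \<and> smooth_section_on A W H Y}) \<subseteq> ?S"
    by (intro span_minimal subspace_span) blast
  then show "T_at q \<subseteq> ?S"
    using sr by (simp add: sub_riemannian_23_def)
qed

end

section \<open>Functions with prescribed derivatives along PBW words\<close>

section \<open>Interpolation of jets in a frame\<close>

lemma three_neq: "(1::3) \<noteq> 2" "(1::3) \<noteq> 3" "(2::3) \<noteq> 3" "(2::3) \<noteq> 1" "(3::3) \<noteq> 1" "(3::3) \<noteq> 2"
  by auto

text \<open>Unlike \<open>multi_apply\<close>, the letters are elements of an index type, so that
  families of fields can be summed over it.\<close>

primrec iter_lie :: "('i \<Rightarrow> 'a vfield) \<Rightarrow> 'i list \<Rightarrow> ('a \<Rightarrow> real) \<Rightarrow> 'a \<Rightarrow> real" where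
  "iter_lie X [] f = f"
| "iter_lie X (i # \<alpha>) f = (\<lambda>q. X i q (iter_lie X \<alpha> f))"

text \<open>A set of words whose operators form a Poincare-Birkhoff-Witt basis up to weighted order 3.\<close>

definition pbw_words :: "3 list list" where
  "pbw_words = [[], [1], [2], [3], [1, 1], [2, 1], [2, 2], [1, 3], [2, 3],
    [1, 1, 1], [2, 1, 1], [2, 2, 1], [2, 2, 2]]"

text \<open>A triangular linear system solved by forward substitution: correcting u by a multiple of
  \<open>m w\<close> does not disturb the conditions for earlier words.\<close>

lemma triangular_interpolation:
  fixes L :: "'w \<Rightarrow> ('a \<Rightarrow> real) \<Rightarrow> real"
  assumes "sorted_wrt (\<lambda>\<alpha> \<beta>. L \<alpha> (m \<beta>) = 0) ws" "distinct ws"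
    and "\<And>\<alpha>. \<alpha> \<in> set ws \<Longrightarrow> L \<alpha> (m \<alpha>) \<noteq> 0"
    and "\<And>\<alpha>. \<alpha> \<in> set ws \<Longrightarrow> S (m \<alpha>)"
    and S: "S (\<lambda>_. 0)" "\<And>f h t. S f \<Longrightarrow> S h \<Longrightarrow> S (\<lambda>x. f x + t * h x)"
    and L: "\<And>\<alpha> f h t. S f \<Longrightarrow> S h \<Longrightarrow> L \<alpha> (\<lambda>x. f x + t * h x) = L \<alpha> f + t * L \<alpha> h"
  shows "\<exists>u. S u \<and> (\<forall>\<alpha>\<in>set ws. L \<alpha> u = c \<alpha>)"
  using assms(1-4)
proof (induction ws rule: rev_induct)
  case Nil
  then show ?case
    using S(1) by auto
next
  case (snoc w ws)
  then obtain u where u: "S u" "\<And>\<alpha>. \<alpha> \<in> set ws \<Longrightarrow> L \<alpha> u = c \<alpha>"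
    by (auto simp: sorted_wrt_append)
  define t where "t = (c w - L w u) / L w (m w)"
  have w: "S (m w)" "L w (m w) \<noteq> 0" "\<And>\<alpha>. \<alpha> \<in> set ws \<Longrightarrow> L \<alpha> (m w) = 0"
    using snoc.prems by (auto simp: sorted_wrt_append)
  have "S (\<lambda>x. u x + t * m w x)"
    by (rule S(2)[OF u(1) w(1)])
  moreover have "L \<alpha> (\<lambda>x. u x + t * m w x) = c \<alpha>" if "\<alpha> \<in> set (ws @ [w])" for \<alpha>
    unfolding L[OF u(1) w(1)] using that u(2) w(2,3) by (auto simp: t_def)
  ultimately show ?case
    by blast
qed

context smooth_manifold
begin

lemma iter_lie_smooth:
  assumes "\<And>i. vf_at q (X i)" "C_at q f"
  shows "C_at q (iter_lie X \<alpha> f)"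
  by (induction \<alpha>) (simp_all add: assms vf_at_smooth)

lemma iter_lie_linear:
  assumes X: "\<And>i. vf_at q (X i)" and f: "C_at q f" and h: "C_at q h"
  shows "\<forall>\<^sub>F r in nhds q. iter_lie X \<alpha> (\<lambda>x. f x + t * h x) r = iter_lie X \<alpha> f r + t * iter_lie X \<alpha> h r"
proof (induction \<alpha>)
  case (Cons i \<alpha>)
  note F = iter_lie_smooth[where X = X and \<alpha> = \<alpha>, OF X f] and H = iter_lie_smooth[where X = X and \<alpha> = \<alpha>, OF X h]
  show ?case
    using lie_cong[OF X Cons.IH, of i] lie_cmult[OF X H, of i t]
      lie_add[OF X F smooth_at_mult[OF smooth_at_const H], of i t]
    by eventually_elim simp
qed simp

end

locale local_frame = smooth_manifold A for A :: "'a::t2_space chart set" +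
  fixes p :: 'a and X :: "3 \<Rightarrow> 'a vfield"
  assumes vf: "vf_at p (X i)"
    and X3: "X 3 = bracket A (X 1) (X 2)"
    and span_X: "span (range (\<lambda>i. X i p)) = T_at p"
begin

lemmas smooth_X = vf_at_smooth[OF vf]
lemmas tangent_X = vf_at_tangent[OF vf]

text \<open>The commutation rule that moves a 1 past a 2, used to bring words into PBW
  order.\<close>

lemma lie_X3:
  assumes "C_at p f"
  shows "\<forall>\<^sub>F r in nhds p. X 1 r (\<lambda>s. X 2 s f) = X 2 r (\<lambda>s. X 1 s f) + X 3 r f"
  using lie_bracket[OF assms, of "X 1" "X 2"] unfolding X3 by eventually_elim simp

text \<open>Both factors vanish at p, so only the terms with one derivative on each survive.\<close>

lemma second_order_product:
  assumes "C_at p f" "C_at p h" "f p = 0" "h p = 0"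
  shows "X i p (\<lambda>r. X j r (\<lambda>x. f x * h x)) = X i p f * X j p h + X j p f * X i p h"
proof -
  have "X i p (\<lambda>r. X j r (\<lambda>x. f x * h x)) = X i p (\<lambda>r. f r * X j r h + h r * X j r f)"
    by (rule tangent_cong[OF tangent_X lie_mult[OF vf assms(1,2)]])
  also have "\<dots> = X i p (\<lambda>r. f r * X j r h) + X i p (\<lambda>r. h r * X j r f)"
    by (rule tangent_add[OF tangent_X smooth_at_mult[OF assms(1) smooth_X[OF assms(2)]]
        smooth_at_mult[OF assms(2) smooth_X[OF assms(1)]]])
  also have "\<dots> = X i p f * X j p h + X j p f * X i p h"
    using assms by (simp add: tangent_mult[OF tangent_X] smooth_X)
  finally show ?thesis .
qed

text \<open>As for two factors: the surviving terms are the six ways of giving one derivative to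
  each factor.\<close>

lemma third_order_product:
  assumes "C_at p f" "C_at p g" "C_at p h" "f p = 0" "g p = 0" "h p = 0"
  shows "X i p (\<lambda>r. X j r (\<lambda>s. X k s (\<lambda>x. f x * (g x * h x)))) =
      (X i p f * X j p g + X j p f * X i p g) * X k p h
    + (X i p f * X j p h + X j p f * X i p h) * X k p g
    + (X i p g * X j p h + X j p g * X i p h) * X k p f"
proof -
  note C = assms(1-3) smooth_X[OF assms(1)] smooth_X[OF assms(2)] smooth_X[OF assms(3)]
  \<comment> \<open>A summand after the innermost derivative has fallen on c;
    \<open>second_order_product\<close> then distributes the other two over a and b.\<close>
  define F where "F = (\<lambda>a b c r. a r * (b r * X k r c))"
  have F: "C_at p (F a b c)" if "C_at p a" "C_at p b" "C_at p c" for a b c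
    unfolding F_def by (rule smooth_at_mult[OF that(1) smooth_at_mult[OF that(2) smooth_X[OF that(3)]]])
  have "\<forall>\<^sub>F s in nhds p. X k s (\<lambda>x. f x * (g x * h x)) = (F f g h s + F f h g s) + F g h f s"
    using lie_mult[OF vf C(1) smooth_at_mult[OF C(2,3)], of k] lie_mult[OF vf C(2,3), of k]
    by eventually_elim (simp add: F_def algebra_simps)
  from lie_cong[OF vf this, of j]
  have "\<forall>\<^sub>F s in nhds p. X j s (\<lambda>s. X k s (\<lambda>x. f x * (g x * h x))) =
      (X j s (F f g h) + X j s (F f h g)) + X j s (F g h f)"
    using lie_add[OF vf smooth_at_add[OF F[OF C(1,2,3)] F[OF C(1,3,2)]] F[OF C(2,3,1)], of j]
      lie_add[OF vf F[OF C(1,2,3)] F[OF C(1,3,2)], of j]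
    by eventually_elim simp
  then have "X i p (\<lambda>r. X j r (\<lambda>s. X k s (\<lambda>x. f x * (g x * h x)))) =
      X i p (\<lambda>s. (X j s (F f g h) + X j s (F f h g)) + X j s (F g h f))"
    by (rule tangent_cong[OF tangent_X])
  also have "\<dots> = X i p (\<lambda>s. X j s (F f g h)) + X i p (\<lambda>s. X j s (F f h g)) + X i p (\<lambda>s. X j s (F g h f))"
    using F C by (simp add: tangent_add[OF tangent_X] smooth_X smooth_at_add)
  also have "X i p (\<lambda>s. X j s (F a b c)) = (X i p a * X j p b + X j p a * X i p b) * X k p c"
    if "C_at p a" "C_at p b" "C_at p c" "a p = 0" "b p = 0" for a b c
    unfolding F_def using that
    by (simp add: second_order_product tangent_mult[OF tangent_X] smooth_at_mult smooth_X algebra_simps)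
  ultimately show ?thesis
    using assms by simp
qed

text \<open>Each word is paired with the monomial in the dual functions having the same letters.
  Words are listed by length; a longer monomial is killed by a shorter word, and at equal length
  different multisets of letters pair to 0. Hence the system is triangular.\<close>

lemma pbw_interpolation:
  obtains u where "C_at p u" "\<And>\<alpha>. \<alpha> \<in> set pbw_words \<Longrightarrow> iter_lie X \<alpha> u p = c \<alpha>"
proof -
  obtain y where y: "\<And>i. C_at p (y i)" "\<And>i. y i p = 0" "\<And>i j. X i p (y j) = (if i = j then 1 else 0)"
    using dual_functions[OF span_X] by metis
  define m where "m = rec_list (\<lambda>_. 1) (\<lambda>i _ f x. y i x * f x)"
  have m: "m [] = (\<lambda>_. 1)" "m (i # \<alpha>) = (\<lambda>x. y i x * m \<alpha> x)" for i \<alpha>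
    by (auto simp: m_def)
  have Cm: "C_at p (m \<alpha>)" for \<alpha>
    by (induction \<alpha>) (simp_all add: m smooth_at_mult y)
  have "\<exists>u. C_at p u \<and> (\<forall>\<alpha>\<in>set pbw_words. iter_lie X \<alpha> u p = c \<alpha>)"
  proof (rule triangular_interpolation[of "\<lambda>\<alpha> f. iter_lie X \<alpha> f p" m])
    note vals = y second_order_product third_order_product tangent_mult[OF tangent_X] smooth_at_mult
    show "sorted_wrt (\<lambda>\<alpha> \<beta>. iter_lie X \<alpha> (m \<beta>) p = 0) pbw_words"
      unfolding pbw_words_def by (simp add: m vals three_neq)
    show "distinct pbw_words"
      unfolding pbw_words_def by (simp add: three_neq)
    show "iter_lie X \<alpha> (m \<alpha>) p \<noteq> 0" if "\<alpha> \<in> set pbw_words" for \<alpha>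
      using that unfolding pbw_words_def by (auto simp: m vals three_neq)
    show "iter_lie X \<alpha> (\<lambda>x. f x + t * h x) p = iter_lie X \<alpha> f p + t * iter_lie X \<alpha> h p"
      if "C_at p f" "C_at p h" for \<alpha> f h t
      using eventually_nhds_x_imp_x[OF iter_lie_linear[OF vf that]] .
    show "C_at p (\<lambda>x. f x + t * h x)" if "C_at p f" "C_at p h" for f h t
      by (rule smooth_at_add[OF that(1) smooth_at_mult[OF smooth_at_const that(2)]])
  qed (auto intro: Cm)
  then show thesis
    using that by blast
qed

end

locale carnot_point = local_frame +
  assumes carnot: "bracket A (X 1) (X 3) p = 0" "bracket A (X 2) (X 3) p = 0"
begin

text \<open>The prescribed values are those of the Heisenberg coordinates at the origin. PBW words
  are handled by interpolation, all others by commutation at p.\<close>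

lemma carnot_coordinates:
  obtains u :: "3 \<Rightarrow> 'a \<Rightarrow> real"
  where "\<And>k. C_at p (u k)" "\<And>k. u k p = 0" "\<And>i k. X i p (u k) = (if i = k then 1 else 0)"
    and "\<And>k i j. i \<in> {1, 2} \<Longrightarrow> j \<in> {1, 2, 3} \<Longrightarrow>
      X i p (\<lambda>r. X j r (u k)) = (if i = 1 \<and> j = 2 \<and> k = 3 then 1 else 0)"
    and "\<And>k i j l. i \<in> {1, 2} \<Longrightarrow> j \<in> {1, 2} \<Longrightarrow> l \<in> {1, 2} \<Longrightarrow>
      X i p (\<lambda>r. X j r (\<lambda>s. X l s (u k))) = 0"
proof -
  have "\<exists>u. C_at p u \<and> (\<forall>\<alpha>\<in>set pbw_words. iter_lie X \<alpha> u p = (if \<alpha> = [k] then 1 else 0))" for k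
    by (rule pbw_interpolation[of "\<lambda>\<alpha>. if \<alpha> = [k] then 1 else 0"]) blast
  then obtain u where Cu: "\<And>k. C_at p (u k)"
    and u: "\<And>k. \<forall>\<alpha>\<in>set pbw_words. iter_lie X \<alpha> (u k) p = (if \<alpha> = [k] then 1 else 0)"
    by metis
  have one_two: "X 1 p (\<lambda>s. X 2 s f) = X 2 p (\<lambda>s. X 1 s f) + X 3 p f" if "C_at p f" for f
    using eventually_nhds_x_imp_x[OF lie_X3[OF that]] .
  have one_two': "X i p (\<lambda>r. X 1 r (\<lambda>s. X 2 s f)) = X i p (\<lambda>r. X 2 r (\<lambda>s. X 1 s f)) + X i p (\<lambda>r. X 3 r f)"
    if "C_at p f" for i f
    using tangent_cong[OF tangent_X lie_X3[OF that]] that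
    by (simp add: tangent_add[OF tangent_X] smooth_X)
  \<comment> \<open>The Carnot condition enters here: at p the third field commutes with the other
    two.\<close>
  have three: "X 3 p (\<lambda>r. X 1 r f) = X 1 p (\<lambda>r. X 3 r f)" "X 3 p (\<lambda>r. X 2 r f) = X 2 p (\<lambda>r. X 3 r f)"
    if "C_at p f" for f
    using fun_cong[OF carnot(1), of f] fun_cong[OF carnot(2), of f] that by (simp_all add: bracket_apply)
  have pbw: "u k p = 0" "X 1 p (u k) = (if 1 = k then 1 else 0)" "X 2 p (u k) = (if 2 = k then 1 else 0)"
    "X 3 p (u k) = (if 3 = k then 1 else 0)"
    "X 1 p (\<lambda>r. X 1 r (u k)) = 0" "X 2 p (\<lambda>r. X 1 r (u k)) = 0" "X 2 p (\<lambda>r. X 2 r (u k)) = 0"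
    "X 1 p (\<lambda>r. X 3 r (u k)) = 0" "X 2 p (\<lambda>r. X 3 r (u k)) = 0"
    "X 1 p (\<lambda>r. X 1 r (\<lambda>s. X 1 s (u k))) = 0" "X 2 p (\<lambda>r. X 1 r (\<lambda>s. X 1 s (u k))) = 0"
    "X 2 p (\<lambda>r. X 2 r (\<lambda>s. X 1 s (u k))) = 0" "X 2 p (\<lambda>r. X 2 r (\<lambda>s. X 2 s (u k))) = 0" for k
    using u[of k] unfolding pbw_words_def by auto
  show thesis
  proof (rule that)
    show "C_at p (u k)" "u k p = 0" for k
      by (fact Cu, fact pbw)
    show "X i p (u k) = (if i = k then 1 else 0)" for i k
      using exhaust_3[of i] pbw[of k] by auto
    show "X i p (\<lambda>r. X j r (u k)) = (if i = 1 \<and> j = 2 \<and> k = 3 then 1 else 0)"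
      if "i \<in> {1, 2}" "j \<in> {1, 2, 3}" for i j k
      using that by (auto simp: pbw one_two Cu three_neq)
    \<comment> \<open>Each exchange of a 1 with a 2 leaves an extra second-order term containing
      \<open>X 3\<close>, which \<open>three\<close> brings to one of the vanishing PBW
      words.\<close>
    have "X 1 p (\<lambda>r. X 2 r (\<lambda>s. X 1 s (u k))) = 0" "X 1 p (\<lambda>r. X 1 r (\<lambda>s. X 2 s (u k))) = 0"
      "X 2 p (\<lambda>r. X 1 r (\<lambda>s. X 2 s (u k))) = 0" "X 1 p (\<lambda>r. X 2 r (\<lambda>s. X 2 s (u k))) = 0" for k
      by (simp_all add: one_two one_two' three smooth_X Cu pbw)
    then show "X i p (\<lambda>r. X j r (\<lambda>s. X l s (u k))) = 0"
      if "i \<in> {1, 2}" "j \<in> {1, 2}" "l \<in> {1, 2}" for i j l k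
      using that pbw by auto
  qed
qed

end

section \<open>Weighted order of vanishing and perturbations of a frame\<close>

section \<open>Weighted order of vanishing\<close>

definition weight :: "3 \<Rightarrow> nat" where
  "weight i = (if i = 3 then 2 else 1)"

context local_frame
begin

text \<open>Weighted order of vanishing greater than m: words of at most m letters 1 and 2, the
  empty one included, are 0 on f at p. The field \<open>X 3\<close> is covered as a commutator, see
  \<open>vanishes_X3\<close>.\<close>

primrec vanishes :: "nat \<Rightarrow> ('a \<Rightarrow> real) \<Rightarrow> bool" where
  "vanishes 0 f \<longleftrightarrow> C_at p f \<and> f p = 0"
| "vanishes (Suc m) f \<longleftrightarrow>
    C_at p f \<and> f p = 0 \<and> vanishes m (\<lambda>r. X 1 r f) \<and> vanishes m (\<lambda>r. X 2 r f)"

lemma vanishes_smooth: "vanishes m f \<Longrightarrow> C_at p f"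
  by (cases m) auto

lemma vanishes_at: "vanishes m f \<Longrightarrow> f p = 0"
  by (cases m) auto

lemma vanishes_cong:
  assumes "vanishes m f" "\<forall>\<^sub>F r in nhds p. f r = h r"
  shows "vanishes m h"
  using assms
proof (induction m arbitrary: f h)
  case 0
  then show ?case
    using smooth_at_cong eventually_nhds_x_imp_x by fastforce
next
  case (Suc m)
  have "vanishes m (\<lambda>r. X i r h)" if "i = 1 \<or> i = 2" for i
    using Suc.IH[OF _ lie_cong[OF vf Suc.prems(2)], of i] Suc.prems(1) that by auto
  then show ?case
    using Suc.prems smooth_at_cong[of p f h] eventually_nhds_x_imp_x[OF Suc.prems(2)] by auto
qed

lemma vanishes_Suc_imp: "vanishes (Suc m) f \<Longrightarrow> vanishes m f"
proof (induction m arbitrary: f)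
  case (Suc m)
  then show ?case
    by (metis vanishes.simps(2))
qed simp

lemma vanishes_mono:
  assumes "vanishes m f" "k \<le> m"
  shows "vanishes k f"
  using assms(2,1) by (induction rule: inc_induct) (blast dest: vanishes_Suc_imp)+

lemma vanishes_zero: "vanishes m (\<lambda>_. 0)"
proof (induction m)
  case (Suc m)
  have "\<forall>\<^sub>F r in nhds p. 0 = X i r (\<lambda>_. 0)" for i
    using vf_at_eventually_tangent[OF vf[of i]] by eventually_elim (simp add: tangent_const)
  then have "vanishes m (\<lambda>r. X i r (\<lambda>_. 0))" for i
    by (rule vanishes_cong[OF Suc])
  then show ?case
    by simp
qed simp

lemma vanishes_add:
  assumes "vanishes m f" "vanishes m h"
  shows "vanishes m (\<lambda>r. f r + h r)"
  using assms
proof (induction m arbitrary: f h)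
  case 0
  then show ?case
    by (simp add: smooth_at_add)
next
  case (Suc m)
  have C: "C_at p f" "C_at p h"
    using Suc.prems by auto
  have "vanishes m (\<lambda>r. X i r (\<lambda>r. f r + h r))" if "i = 1 \<or> i = 2" for i
  proof (rule vanishes_cong)
    show "vanishes m (\<lambda>r. X i r f + X i r h)"
      using Suc.IH[of "\<lambda>r. X i r f" "\<lambda>r. X i r h"] Suc.prems that by auto
    show "\<forall>\<^sub>F r in nhds p. X i r f + X i r h = X i r (\<lambda>r. f r + h r)"
      using lie_add[OF vf C, of i] by eventually_elim simp
  qed
  then show ?case
    using Suc.prems C by (simp add: smooth_at_add)
qed

text \<open>The vanishing functions form an ideal: under the product rule one term keeps f, of which
  less is asked, and the other has the derivative of f.\<close>

lemma vanishes_mult: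
  assumes "vanishes m f" "C_at p h"
  shows "vanishes m (\<lambda>r. f r * h r)"
  using assms
proof (induction m arbitrary: f h)
  case 0
  then show ?case
    by (simp add: smooth_at_mult)
next
  case (Suc m)
  have C: "C_at p f" "C_at p h"
    using Suc.prems by auto
  have "vanishes m (\<lambda>r. X i r (\<lambda>r. f r * h r))" if "i = 1 \<or> i = 2" for i
  proof (rule vanishes_cong)
    show "vanishes m (\<lambda>r. f r * X i r h + X i r f * h r)"
      using Suc.IH[OF vanishes_Suc_imp[OF Suc.prems(1)] smooth_X[OF C(2)], of i]
        Suc.IH[of "\<lambda>r. X i r f" h] Suc.prems that C
      by (intro vanishes_add) auto
    show "\<forall>\<^sub>F r in nhds p. f r * X i r h + X i r f * h r = X i r (\<lambda>r. f r * h r)"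
      using lie_mult[OF vf C, of i] by eventually_elim simp
  qed
  then show ?case
    using Suc.prems C by (simp add: smooth_at_mult)
qed

lemma vanishes_sum: "(\<And>i. i \<in> I \<Longrightarrow> vanishes m (f i)) \<Longrightarrow> vanishes m (\<lambda>r. \<Sum>i\<in>I. f i r)"
  by (induction I rule: infinite_finite_induct) (simp_all add: vanishes_zero vanishes_add)

lemma vanishes_diff:
  assumes "vanishes m f" "vanishes m h"
  shows "vanishes m (\<lambda>r. f r - h r)"
  using vanishes_add[OF assms(1) vanishes_mult[OF assms(2) smooth_at_const[of p "- 1"]]] by simp

text \<open>As a commutator of two fields, \<open>X 3\<close> costs two orders, which is its
  weight.\<close>

lemma vanishes_X3:
  assumes "vanishes (Suc (Suc m)) f"
  shows "vanishes m (\<lambda>r. X 3 r f)"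
proof (rule vanishes_cong)
  show "vanishes m (\<lambda>r. X 1 r (\<lambda>s. X 2 s f) - X 2 r (\<lambda>s. X 1 s f))"
    using assms by (intro vanishes_diff) auto
  show "\<forall>\<^sub>F r in nhds p. X 1 r (\<lambda>s. X 2 s f) - X 2 r (\<lambda>s. X 1 s f) = X 3 r f"
    using lie_X3[OF vanishes_smooth[OF assms]] by eventually_elim simp
qed

text \<open>The perturbation of each field is chosen so small that it lowers the weighted order of
  vanishing by no more than the field itself.\<close>

lemma vanishes_iter_lie_diff:
  assumes Z: "\<And>i. vf_at p (Z i)"
    and e: "\<And>i j. vanishes (3 - weight i) (e i j)"
    and Ze: "\<And>i. \<forall>\<^sub>F r in nhds p. Z i r = X i r + (\<Sum>j\<in>UNIV. e i j r *\<^sub>R X j r)"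
    and f: "C_at p f" and "sum_list (map weight \<alpha>) \<le> 3"
  shows "vanishes (3 - sum_list (map weight \<alpha>)) (\<lambda>r. iter_lie Z \<alpha> f r - iter_lie X \<alpha> f r)"
  using assms(5)
proof (induction \<alpha>)
  case Nil
  show ?case
    using vanishes_zero by simp
next
  case (Cons i \<alpha>)
  define w where "w = sum_list (map weight \<alpha>)"
  define g where "g = iter_lie Z \<alpha> f"
  define h where "h = iter_lie X \<alpha> f"
  have w: "weight i + w \<le> 3"
    using Cons.prems by (simp add: w_def)
  have IH: "vanishes (3 - w) (\<lambda>r. g r - h r)"
    using Cons by (simp add: w_def g_def h_def)
  have g: "C_at p g" and h: "C_at p h"
    unfolding g_def h_def by (intro iter_lie_smooth Z vf f)+
  have "vanishes (3 - (weight i + w)) (\<lambda>r. X i r (\<lambda>r. g r - h r))"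
  proof -
    consider "i = 1" | "i = 2" | "i = 3"
      using exhaust_3 by blast
    then show ?thesis
    proof cases
      case 1
      then have "3 - w = Suc (3 - (weight i + w))"
        using w by (simp add: weight_def)
      then show ?thesis
        using IH 1 by simp
    next
      case 2
      then have "3 - w = Suc (3 - (weight i + w))"
        using w by (simp add: weight_def)
      then show ?thesis
        using IH 2 by simp
    next
      case 3
      then have "3 - w = Suc (Suc (3 - (weight i + w)))"
        using w by (simp add: weight_def)
      then show ?thesis
        using vanishes_X3 IH 3 by simp
    qed
  qed
  \<comment> \<open>Here g may be any smooth function: the coefficients alone vanish to the required
    order.\<close>
  moreover have "vanishes (3 - (weight i + w)) (\<lambda>r. \<Sum>j\<in>UNIV. e i j r * X j r g)"
    by (intro vanishes_sum vanishes_mult smooth_X g vanishes_mono[OF e]) simp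
  ultimately have "vanishes (3 - (weight i + w))
      (\<lambda>r. X i r (\<lambda>r. g r - h r) + (\<Sum>j\<in>UNIV. e i j r * X j r g))"
    by (rule vanishes_add)
  \<comment> \<open>The difference of the operators splits as \<open>X i\<close> applied to g - h
    plus the perturbation applied to g.\<close>
  then have "vanishes (3 - (weight i + w)) (\<lambda>r. Z i r g - X i r h)"
  proof (rule vanishes_cong)
    show "\<forall>\<^sub>F r in nhds p. X i r (\<lambda>r. g r - h r) + (\<Sum>j\<in>UNIV. e i j r * X j r g) = Z i r g - X i r h"
      using Ze[of i] lie_diff[OF vf g h, of i] by eventually_elim (simp add: sum_scaleR_fun_apply)
  qed
  then show ?case
    by (simp add: w_def g_def h_def)
qed

end

section \<open>Construction of the Heisenberg frame at a Carnot point\<close>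

section \<open>The Heisenberg frame\<close>

lemma independent_rangeI:
  fixes v :: "'n::finite \<Rightarrow> 'v::real_vector"
  assumes "inj v" and zero: "\<And>c. (\<Sum>i\<in>UNIV. c i *\<^sub>R v i) = 0 \<Longrightarrow> \<forall>i. c i = 0"
  shows "independent (range v)"
proof (rule independent_if_scalars_zero)
  fix c x assume c: "(\<Sum>x\<in>range v. c x *\<^sub>R x) = 0" and "x \<in> range v"
  then obtain i where x: "x = v i"
    by blast
  have "(\<Sum>i\<in>UNIV. c (v i) *\<^sub>R v i) = 0"
    using c by (simp add: sum.reindex[OF assms(1)] o_def)
  then show "c x = 0"
    using zero[of "\<lambda>i. c (v i)"] x by simp
qed simp

context local_frame
begin

lemma vanishes_order_2I:
  assumes "C_at p f" "f p = 0" "\<And>i. i \<in> {1, 2} \<Longrightarrow> X i p f = 0"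
    and "\<And>i j. i \<in> {1, 2} \<Longrightarrow> j \<in> {1, 2} \<Longrightarrow> X i p (\<lambda>r. X j r f) = 0"
  shows "vanishes 2 f"
  using assms by (simp add: numeral_2_eq_2 smooth_X)

lemma vanishes_order_1I:
  assumes "C_at p f" "f p = 0" "\<And>i. i \<in> {1, 2} \<Longrightarrow> X i p f = 0"
  shows "vanishes 1 f"
  using assms by (simp add: smooth_X)

lemma second_order_diff:
  assumes "C_at p f" "C_at p h"
  shows "X i p (\<lambda>r. X j r (\<lambda>x. f x - h x)) = X i p (\<lambda>r. X j r f) - X i p (\<lambda>r. X j r h)"
  using tangent_cong[OF tangent_X lie_diff[OF vf assms]]
  by (simp add: tangent_diff[OF tangent_X] smooth_X assms)

lemma second_order_const: "X i p (\<lambda>r. X j r (\<lambda>_. c)) = 0"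
proof -
  have "\<forall>\<^sub>F r in nhds p. X j r (\<lambda>_. c) = 0"
    using vf_at_eventually_tangent[OF vf[of j]] by eventually_elim (rule tangent_const)
  then have "X i p (\<lambda>r. X j r (\<lambda>_. c)) = X i p (\<lambda>_. 0)"
    by (rule tangent_cong[OF tangent_X])
  then show ?thesis
    by (simp add: tangent_const[OF tangent_X])
qed

end

text \<open>Row \<open>i\<close> lists the derivatives of the coordinates \<open>x, y, z\<close> along the \<open>i\<close>-th of the
  Heisenberg fields \<open>\<partial>\<^sub>x\<close>, \<open>\<partial>\<^sub>y + x \<partial>\<^sub>z\<close>, \<open>\<partial>\<^sub>z\<close> at a point with first coordinate \<open>x\<close>.\<close>

definition heisenberg_matrix :: "real \<Rightarrow> real^3^3" where
  "heisenberg_matrix x = (\<chi> i k. if i = k then 1 else if i = 2 \<and> k = 3 then x else 0)"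

lemma det_heisenberg_matrix: "det (heisenberg_matrix x) = 1"
  by (simp add: heisenberg_matrix_def det_3)

text \<open>The matrix is unitriangular: columns 1 and 2 give the first two coefficients, column 3
  then the last.\<close>

lemma heisenberg_combination_zero:
  assumes "\<And>k. (\<Sum>i\<in>UNIV. c i * heisenberg_matrix x $ i $ k) = 0"
  shows "c i = 0"
proof -
  have "c 1 = 0" "c 2 = 0" "c 2 * x + c 3 = 0"
    using assms[of 1] assms[of 2] assms[of 3]
    by (simp_all add: heisenberg_matrix_def sum_3 three_neq)
  then show ?thesis
    using exhaust_3[of i] by auto
qed

context carnot_point
begin

lemma heisenberg_frame:
  assumes U: "open U" "p \<in> U" and vfU: "\<And>q i. q \<in> U \<Longrightarrow> vf_at q (X i)"
    and spanU: "\<And>q. q \<in> U \<Longrightarrow> span (range (\<lambda>i. X i q)) = T_at q"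
  obtains V Z where "open V" "p \<in> V" "V \<subseteq> U"
    and "\<And>q i. q \<in> V \<Longrightarrow> vf_at q (Z i)"
    and "\<And>q. q \<in> V \<Longrightarrow> span (range (\<lambda>i. Z i q)) = T_at q"
    and "\<And>q. q \<in> V \<Longrightarrow> inj (\<lambda>i. Z i q)"
    and "\<And>q. q \<in> V \<Longrightarrow> independent (range (\<lambda>i. Z i q))"
    and "\<And>q. q \<in> V \<Longrightarrow> bracket A (Z 1) (Z 2) q = Z 3 q"
    and "\<And>q. q \<in> V \<Longrightarrow> bracket A (Z 3) (Z 1) q = 0"
    and "\<And>q. q \<in> V \<Longrightarrow> bracket A (Z 2) (Z 3) q = 0"
    and "\<And>\<alpha> f. C_at p f \<Longrightarrow> sum_list (map weight \<alpha>) \<le> 3 \<Longrightarrow> iter_lie Z \<alpha> f p = iter_lie X \<alpha> f p"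
proof -
  obtain u :: "3 \<Rightarrow> 'a \<Rightarrow> real" where
        Cu: "\<And>k. C_at p (u k)" and u0: "\<And>k. u k p = 0"
    and u1: "\<And>i k. X i p (u k) = (if i = k then 1 else 0)"
    and u2: "\<And>k i j. i \<in> {1, 2} \<Longrightarrow> j \<in> {1, 2, 3} \<Longrightarrow>
      X i p (\<lambda>r. X j r (u k)) = (if i = 1 \<and> j = 2 \<and> k = 3 then 1 else 0)"
    and u3: "\<And>k i j l. i \<in> {1, 2} \<Longrightarrow> j \<in> {1, 2} \<Longrightarrow> l \<in> {1, 2} \<Longrightarrow>
      X i p (\<lambda>r. X j r (\<lambda>s. X l s (u k))) = 0"
    by (rule carnot_coordinates) (rule that)
  define P where "P r = (\<chi> j k. X j r (u k))" for r
  define Q where "Q r = matrix_inv (P r)" for r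
  define W where "W r = heisenberg_matrix (u 1 r)" for r
  define B where "B i j r = (W r ** Q r) $ i $ j" for i j r
  define Z where "Z i r = (\<Sum>j\<in>UNIV. B i j r *\<^sub>R X j r)" for i r

  have CP: "C_at p (\<lambda>r. P r $ j $ k)" for j k
    by (simp add: P_def smooth_X[OF Cu])
  have W_entry: "(\<lambda>r. W r $ i $ k) = (if i = k then (\<lambda>_. 1) else if i = 2 \<and> k = 3 then u 1 else (\<lambda>_. 0))" for i k
    by (auto simp: W_def heisenberg_matrix_def fun_eq_iff)
  have CW: "C_at p (\<lambda>r. W r $ i $ k)" for i k
    unfolding W_entry by (simp add: Cu)
  have "P p = mat 1"
    by (simp add: P_def mat_def u1)
  then have "det (P p) \<noteq> 0"
    by simp
  note P_inv = smooth_at_matrix_inv[OF CP this, folded Q_def]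
  have CB: "C_at p (B i j)" for i j
  proof -
    have "B i j = (\<lambda>r. \<Sum>k\<in>UNIV. W r $ i $ k * Q r $ k $ j)"
      by (simp add: B_def matrix_matrix_mult_def fun_eq_iff)
    then show ?thesis
      using smooth_at_sum[OF smooth_at_mult[OF CW P_inv(2)]] by simp
  qed

  \<comment> \<open>Rows 1 and 2 are compared up to second derivatives, through \<open>u1\<close>,
    \<open>u2\<close> and \<open>u3\<close>; row 3 only up to first ones. The one nonconstant entry
    of W, \<open>u 1\<close>, matches \<open>X 2\<close> applied to \<open>u 3\<close>.\<close>
  have vanW: "vanishes (3 - weight i) (\<lambda>r. W r $ i $ k - P r $ i $ k)" for i k
  proof -
    have C: "C_at p (\<lambda>r. W r $ i $ k - P r $ i $ k)"
      by (rule smooth_at_diff[OF CW CP])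
    have at: "W p $ i $ k - P p $ i $ k = 0"
      by (simp add: W_def P_def heisenberg_matrix_def u0 u1)
    have first: "X j p (\<lambda>r. W r $ i $ k - P r $ i $ k) = 0" if "j \<in> {1, 2}" for j
      using that exhaust_3[of i] u2[of j i k]
      by (subst tangent_diff[OF tangent_X CW CP])
        (auto simp: W_entry P_def tangent_const[OF tangent_X] u1 three_neq)
    have second: "X l p (\<lambda>r. X j r (\<lambda>s. W s $ i $ k - P s $ i $ k)) = 0"
      if "l \<in> {1, 2}" "j \<in> {1, 2}" "i \<noteq> 3" for l j
      using that exhaust_3[of i] u3[of l j i k] u2[of l j 1]
      by (subst second_order_diff[OF CW CP])
        (auto simp: W_entry P_def second_order_const three_neq)
    show ?thesis
      using vanishes_order_1I[OF C at first] vanishes_order_2I[OF C at first second]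
      by (cases "i = 3") (auto simp: weight_def)
  qed
  define e where "e i j r = (\<Sum>k\<in>UNIV. (W r $ i $ k - P r $ i $ k) * Q r $ k $ j)" for i j r
  have van_e: "vanishes (3 - weight i) (e i j)" for i j
    unfolding e_def by (intro vanishes_sum vanishes_mult vanW P_inv(2))
  have vfZ: "vf_at p (Z i)" for i
    unfolding Z_def by (rule vf_at_sum_scaleR[OF CB vf]) simp
  have Ze: "\<forall>\<^sub>F r in nhds p. Z i r = X i r + (\<Sum>j\<in>UNIV. e i j r *\<^sub>R X j r)" for i
    using P_inv(1)
  proof eventually_elim
    case (elim r)
    \<comment> \<open>Since P Q is the identity, (W - P) Q is B minus the identity.\<close>
    have B: "B i j r = (if i = j then 1 else 0) + e i j r" for j
    proof -
      have "e i j r = B i j r - (P r ** Q r) $ i $ j"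
        by (simp add: e_def B_def matrix_matrix_mult_def left_diff_distrib sum_subtractf)
      then show ?thesis
        using matrix_inv_det_nz(1)[OF elim] by (simp add: Q_def mat_def)
    qed
    have "Z i r = (\<Sum>j\<in>UNIV. (if i = j then 1 else 0) *\<^sub>R X j r) + (\<Sum>j\<in>UNIV. e i j r *\<^sub>R X j r)"
      by (simp only: Z_def B scaleR_add_left sum.distrib)
    also have "(\<Sum>j\<in>UNIV. (if i = j then 1 else 0) *\<^sub>R X j r) = X i r"
      by (simp add: if_distrib[where f = "\<lambda>c. c *\<^sub>R _"] cong: if_cong)
    finally show ?case .
  qed
  have agree: "iter_lie Z \<alpha> f p = iter_lie X \<alpha> f p"
    if "C_at p f" "sum_list (map weight \<alpha>) \<le> 3" for \<alpha> f
    using vanishes_at[OF vanishes_iter_lie_diff[OF vfZ van_e Ze that]] by simp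

  have "\<forall>\<^sub>F r in nhds p. r \<in> U"
    using U eventually_nhds by blast
  moreover have "\<forall>\<^sub>F r in nhds p. \<forall>i. \<forall>j. C_at r (B i j)"
    by (intro eventually_all_finite smooth_at_eventually CB)
  moreover have "\<forall>\<^sub>F r in nhds p. \<forall>i. C_at r (u i)"
    by (intro eventually_all_finite smooth_at_eventually Cu)
  ultimately have "\<forall>\<^sub>F r in nhds p. r \<in> U \<and> det (P r) \<noteq> 0 \<and> (\<forall>i j. C_at r (B i j)) \<and> (\<forall>i. C_at r (u i))"
    using P_inv(1) by eventually_elim simp
  \<comment> \<open>The set is shrunk until P is invertible and all coefficients and
    \<open>u k\<close> are smooth at each of its points.\<close>
  then obtain V where V: "open V" "p \<in> V"
    and V': "\<And>q. q \<in> V \<Longrightarrow> q \<in> U \<and> det (P q) \<noteq> 0 \<and> (\<forall>i j. C_at q (B i j)) \<and> (\<forall>i. C_at q (u i))"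
    unfolding eventually_nhds by metis
  have VU: "V \<subseteq> U" and VB: "\<And>q i j. q \<in> V \<Longrightarrow> C_at q (B i j)"
    and Vu: "\<And>q i. q \<in> V \<Longrightarrow> C_at q (u i)" and VP: "\<And>q. q \<in> V \<Longrightarrow> det (P q) \<noteq> 0"
    using V' by auto
  have vfV: "vf_at q (Z i)" if "q \<in> V" for q i
    unfolding Z_def by (rule vf_at_sum_scaleR[OF VB[OF that] vfU]) (use that VU in auto)
  have Zu: "Z i q (u k) = W q $ i $ k" if "q \<in> V" for q i k
  proof -
    have "Z i q (u k) = (W q ** Q q ** P q) $ i $ k"
      by (simp add: Z_def B_def sum_scaleR_fun_apply P_def matrix_matrix_mult_def)
    also have "W q ** Q q ** P q = W q"
      using matrix_inv_det_nz(2)[OF VP[OF that]] by (simp add: Q_def flip: matrix_mul_assoc)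
    finally show ?thesis .
  qed
  have combination_zero: "c i = 0"
    if "q \<in> V" "\<And>k. (\<Sum>i\<in>UNIV. c i *\<^sub>R Z i q) (u k) = 0" for q c i
    by (rule heisenberg_combination_zero[of c "u 1 q"])
      (use that in \<open>simp add: sum_scaleR_fun_apply Zu W_def\<close>)
  have span_Z: "span (range (\<lambda>i. Z i q)) = T_at q" if q: "q \<in> V" for q
  proof
    show "span (range (\<lambda>i. Z i q)) \<subseteq> T_at q"
      using vf_at_tangent[OF vfV[OF q]] by (intro span_minimal subspace_tangent) auto
    have "det (W q ** Q q) \<noteq> 0"
    proof -
      have "det (P q) * det (Q q) = 1"
        using matrix_inv_det_nz(1)[OF VP[OF q]] by (simp add: Q_def flip: det_mul)
      then show ?thesis
        by (auto simp: det_mul W_def det_heisenberg_matrix)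
    qed
    note inv = matrix_inv_det_nz(2)[OF this]
    \<comment> \<open>The inverse of the coefficient matrix B, which expresses the
      \<open>X j\<close> through the \<open>Z i\<close>.\<close>
    define M where "M = matrix_inv (W q ** Q q)"
    have "X j q \<in> span (range (\<lambda>i. Z i q))" for j
    proof -
      have "(\<Sum>i\<in>UNIV. M $ j $ i *\<^sub>R Z i q) = (\<Sum>k\<in>UNIV. (\<Sum>i\<in>UNIV. M $ j $ i * B i k q) *\<^sub>R X k q)"
        unfolding Z_def scaleR_sum_right scaleR_sum_left
        by (subst sum.swap) simp
      also have "\<dots> = (\<Sum>k\<in>UNIV. (if j = k then 1 else 0) *\<^sub>R X k q)"
        using arg_cong[OF inv, of "\<lambda>m. m $ j $ _"]
        by (simp add: M_def B_def matrix_matrix_mult_def mat_def)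
      also have "\<dots> = X j q"
        by (simp add: if_distrib[where f = "\<lambda>c. c *\<^sub>R _"] cong: if_cong)
      finally have "X j q = (\<Sum>i\<in>UNIV. M $ j $ i *\<^sub>R Z i q)" ..
      then show ?thesis
        by (auto intro: span_sum span_scale span_base)
    qed
    then have "span (range (\<lambda>j. X j q)) \<subseteq> span (range (\<lambda>i. Z i q))"
      by (intro span_minimal subspace_span) auto
    then show "T_at q \<subseteq> span (range (\<lambda>i. Z i q))"
      using spanU[of q] q VU by auto
  qed
  have inj: "inj (\<lambda>i. Z i q)" if q: "q \<in> V" for q
  proof (rule injI)
    fix i j assume "Z i q = Z j q"
    then have "W q $ i $ k = W q $ j $ k" for k
      using Zu[OF q] by metis
    \<comment> \<open>The first two columns already tell the three rows apart.\<close>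
    from this[of 1] this[of 2] show "i = j"
      using exhaust_3[of i] exhaust_3[of j] by (auto simp: W_def heisenberg_matrix_def)
  qed
  have indep: "independent (range (\<lambda>i. Z i q))" if q: "q \<in> V" for q
  proof (rule independent_rangeI[OF inj[OF q]])
    fix c assume "(\<Sum>i\<in>UNIV. c i *\<^sub>R Z i q) = 0"
    then have "(\<Sum>i\<in>UNIV. c i *\<^sub>R Z i q) (u k) = 0" for k
      by (simp only: zero_fun_apply)
    then show "\<forall>i. c i = 0"
      using combination_zero[OF q, of c] by metis
  qed
  \<comment> \<open>The functions \<open>u k\<close> separate tangent vectors on V, so an identity
    between fields need only be tested on them.\<close>
  have zeroI: "v = 0" if q: "q \<in> V" and v: "v \<in> T_at q" and vu: "\<And>k. v (u k) = 0" for q v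
  proof -
    obtain c where c: "v = (\<Sum>i\<in>UNIV. c i *\<^sub>R Z i q)"
      using span_range_finite[of v "\<lambda>i. Z i q"] v span_Z[OF q] by metis
    have "c i = 0" for i
      using vu unfolding c by (rule combination_zero[OF q])
    then show ?thesis
      by (simp add: c)
  qed
  \<comment> \<open>As \<open>Z i\<close> acts on \<open>u k\<close> by an entry of W throughout the
    open set V, the bracket only differentiates entries of W.\<close>
  have bracket_u: "bracket A (Z i) (Z j) q (u k) = Z i q (\<lambda>r. W r $ j $ k) - Z j q (\<lambda>r. W r $ i $ k)"
    if q: "q \<in> V" for q i j k
  proof -
    have "\<forall>\<^sub>F r in nhds q. r \<in> V"
      using V(1) q by (rule eventually_nhds_in_open)
    then have "\<forall>\<^sub>F r in nhds q. Z i r (u k) = W r $ i $ k" for i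
      by eventually_elim (rule Zu)
    then have "Z l q (\<lambda>r. Z i r (u k)) = Z l q (\<lambda>r. W r $ i $ k)" for l i
      by (rule tangent_cong[OF vf_at_tangent[OF vfV[OF q]]])
    then show ?thesis
      by (simp only: bracket_apply[OF Vu[OF q]])
  qed
  have bracket_T: "bracket A (Z i) (Z j) q \<in> T_at q" if "q \<in> V" for q i j
    by (intro bracket_tangent vfV that)
  note Z_const = tangent_const[OF vf_at_tangent[OF vfV]]
  show thesis
  proof (rule that[OF V VU vfV span_Z inj indep _ _ _ agree])
    fix q assume q: "q \<in> V"
    \<comment> \<open>All entries of W are constant except \<open>u 1\<close> in row 2, column 3,
      and among the \<open>Z i\<close> only \<open>Z 1\<close> has a nonzero derivative there,
      namely 1. This is the value of \<open>Z 3\<close> on \<open>u 3\<close>.\<close>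
    have "(bracket A (Z 1) (Z 2) q - Z 3 q) (u k) = 0" for k
      using exhaust_3[of k] q
      by (auto simp: bracket_u W_entry Z_const Zu) (auto simp: W_def heisenberg_matrix_def)
    then have "bracket A (Z 1) (Z 2) q - Z 3 q = 0"
      by (intro zeroI[OF q] subspace_diff[OF subspace_tangent] bracket_T[OF q] vf_at_tangent[OF vfV[OF q]])
    then show "bracket A (Z 1) (Z 2) q = Z 3 q"
      by simp
    have "bracket A (Z 3) (Z 1) q (u k) = 0" "bracket A (Z 2) (Z 3) q (u k) = 0" for k
      using exhaust_3[of k] q
      by (auto simp: bracket_u W_entry Z_const Zu) (auto simp: W_def heisenberg_matrix_def)
    then show "bracket A (Z 3) (Z 1) q = 0" "bracket A (Z 2) (Z 3) q = 0"
      using zeroI[OF q bracket_T[OF q]] by blast+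
  qed
qed

end

section \<open>Multi-indices over the type 3, and the two implications\<close>

section \<open>Equivalence of Carnot frames and flattenings\<close>

text \<open>The entries 1, 2, 3 have distinct images under \<open>of_nat\<close> in the type 3, so
  list positions and typed indices correspond.\<close>

lemma multi_apply_iter_lie:
  assumes "multi_index \<alpha>"
  shows "multi_apply [X 1, X 2, X 3] \<alpha> f = iter_lie X (map (of_nat :: nat \<Rightarrow> 3) \<alpha>) f"
  using assms
proof (induction \<alpha>)
  case Nil
  show ?case
    by (simp add: multi_apply_def)
next
  case (Cons i \<alpha>)
  then have "i = 1 \<or> i = 2 \<or> i = 3"
    by (auto simp: multi_index_def)
  then have "[X 1, X 2, X 3] ! (i - 1) = X (of_nat i :: 3)"
    by auto
  moreover have "multi_apply [X 1, X 2, X 3] \<alpha> f = iter_lie X (map (of_nat :: nat \<Rightarrow> 3) \<alpha>) f"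
    using Cons by (simp add: multi_index_def)
  ultimately show ?case
    by (simp add: multi_apply_def)
qed

lemma weighted_order_eq_weight:
  assumes "multi_index \<alpha>"
  shows "weighted_order \<alpha> = sum_list (map weight (map (of_nat :: nat \<Rightarrow> 3) \<alpha>))"
  using assms
proof (induction \<alpha>)
  case Nil
  show ?case
    by (simp add: weighted_order_def)
next
  case (Cons i \<alpha>)
  then have "i = 1 \<or> i = 2 \<or> i = 3"
    by (auto simp: multi_index_def)
  then show ?case
    using Cons by (auto simp: multi_index_def weighted_order_def weight_def)
qed

lemma (in smooth_manifold) frame_onI:
  assumes "open V" "\<And>q i. q \<in> V \<Longrightarrow> vf_at q (Z i)" "\<And>q. q \<in> V \<Longrightarrow> inj (\<lambda>i::3. Z i q)"
    and "\<And>q. q \<in> V \<Longrightarrow> independent (range (\<lambda>i. Z i q))"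
    and "\<And>q. q \<in> V \<Longrightarrow> span (range (\<lambda>i. Z i q)) = T_at q"
  shows "frame_on A V T_at [Z 1, Z 2, Z 3]"
proof -
  have r: "range (\<lambda>i. Z i q) = {Z 1 q, Z 2 q, Z 3 q}" for q
    by (simp add: UNIV_3)
  have "distinct [Z 1 q, Z 2 q, Z 3 q]" if "q \<in> V" for q
    using inj_eq[OF assms(3)[OF that]] by (simp add: three_neq)
  then show ?thesis
    using assms(1,2) assms(4,5)[unfolded r] vf_at_tangent
    by (auto simp: frame_on_def smooth_section_on_def smooth_vfield_on_iff)
qed

lemma carnot_if_flattening:
  assumes fl: "flattening A H ip g p Uh ghat Xh1 Xh2 Xh3"
    and ag: "\<And>\<alpha>. multi_index \<alpha> \<Longrightarrow> weighted_order \<alpha> \<in> {1, 2, 3} \<Longrightarrow>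
      agree_at A p [Xh1, Xh2, Xh3] [X1, X2, X3] \<alpha>"
  shows "bracket A X1 X3 p = 0" "bracket A X2 X3 p = 0"
proof -
  have hat: "p \<in> Uh" "\<And>q. q \<in> Uh \<Longrightarrow> bracket A Xh3 Xh1 q = 0 \<and> bracket A Xh2 Xh3 q = 0"
    using fl by (auto simp: flattening_def)
  have hat_zero: "Xh3 p (\<lambda>r. Xh1 r f) - Xh1 p (\<lambda>r. Xh3 r f) = 0"
    "Xh2 p (\<lambda>r. Xh3 r f) - Xh3 p (\<lambda>r. Xh2 r f) = 0" if "smooth_at A p f" for f
  proof -
    have "bracket A Xh3 Xh1 p f = 0" "bracket A Xh2 Xh3 p f = 0"
      using hat by auto
    then show "Xh3 p (\<lambda>r. Xh1 r f) - Xh1 p (\<lambda>r. Xh3 r f) = 0"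
      "Xh2 p (\<lambda>r. Xh3 r f) - Xh3 p (\<lambda>r. Xh2 r f) = 0"
      using that by (simp_all add: bracket_def)
  qed
  \<comment> \<open>The four words that occur in the two brackets, each of weighted order 3.\<close>
  have "agree_at A p [Xh1, Xh2, Xh3] [X1, X2, X3] \<alpha>"
    if "\<alpha> \<in> {[1, 3], [3, 1], [2, 3], [3, 2]}" for \<alpha>
    using that by (intro ag) (auto simp: multi_index_def weighted_order_def)
  from this[of "[1, 3]"] this[of "[3, 1]"] this[of "[2, 3]"] this[of "[3, 2]"]
  have "Xh1 p (\<lambda>r. Xh3 r f) = X1 p (\<lambda>r. X3 r f)" "Xh3 p (\<lambda>r. Xh1 r f) = X3 p (\<lambda>r. X1 r f)"
    "Xh2 p (\<lambda>r. Xh3 r f) = X2 p (\<lambda>r. X3 r f)" "Xh3 p (\<lambda>r. Xh2 r f) = X3 p (\<lambda>r. X2 r f)"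
    if "smooth_at A p f" for f
    using that by (simp_all add: agree_at_def multi_apply_def)
  then show "bracket A X1 X3 p = 0" "bracket A X2 X3 p = 0"
    using hat_zero by (auto simp: bracket_def fun_eq_iff)
qed

theorem theorem13:
  fixes A :: "'a::{t2_space, second_countable_topology} chart set"
    and H :: "'a \<Rightarrow> 'a tvec set"
    and ip :: "'a \<Rightarrow> 'a tvec \<Rightarrow> 'a tvec \<Rightarrow> real"
    and g :: "'a cometric"
    and U :: "'a set" and p :: 'a
    and X1 X2 X3 :: "'a vfield"
  assumes "sub_riemannian_23 A H ip" and "orientable A"
    and "associated_cometric A H ip g"
    and "open U" and "p \<in> U"
    and "orthonormal_frame A H ip U X1 X2"
    and "X3 = bracket A X1 X2"
  shows "carnot_frame A H ip U p X1 X2 \<longleftrightarrow>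
    (\<exists>Uh ghat Xh1 Xh2 Xh3.
       open Uh \<and> p \<in> Uh \<and> Uh \<subseteq> U \<and>
       flattening A H ip g p Uh ghat Xh1 Xh2 Xh3 \<and>
       (\<forall>\<alpha>. multi_index \<alpha> \<and> weighted_order \<alpha> \<in> {1, 2, 3} \<longrightarrow>
          agree_at A p [Xh1, Xh2, Xh3] [X1, X2, X3] \<alpha>))"
proof
  interpret smooth_manifold A
    using assms(1) by unfold_locales (simp add: sub_riemannian_23_def)
  define X where "X i = (if i = 1 then X1 else if i = 2 then X2 else X3)" for i :: 3
  have X: "X 1 = X1" "X 2 = X2" "X 3 = X3"
    by (simp_all add: X_def three_neq)
  assume carnot: "carnot_frame A H ip U p X1 X2"
  note vf12 = orthonormal_frame_vf_at[OF assms(4,6)]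
  have vfU: "vf_at q (X i)" if "q \<in> U" for q i
    using vf12[OF that] vf_at_bracket[OF vf12[OF that]] by (simp add: X_def assms(7))
  have spanU: "span (range (\<lambda>i. X i q)) = T_at q" if "q \<in> U" for q
    using span_frame_bracket[OF assms(1,4) that assms(6)] by (simp add: UNIV_3 X assms(7))
  interpret carnot_point A p X
    using carnot vfU[OF assms(5)] spanU[OF assms(5)]
    by unfold_locales (auto simp: carnot_frame_def Let_def X assms(7))
  obtain V Z where V: "open V" "p \<in> V" "V \<subseteq> U"
    and vfZ: "\<And>q i. q \<in> V \<Longrightarrow> vf_at q (Z i)"
    and span_Z: "\<And>q. q \<in> V \<Longrightarrow> span (range (\<lambda>i. Z i q)) = T_at q"
    and inj: "\<And>q. q \<in> V \<Longrightarrow> inj (\<lambda>i. Z i q)"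
    and indep: "\<And>q. q \<in> V \<Longrightarrow> independent (range (\<lambda>i. Z i q))"
    and br: "\<And>q. q \<in> V \<Longrightarrow> bracket A (Z 1) (Z 2) q = Z 3 q"
      "\<And>q. q \<in> V \<Longrightarrow> bracket A (Z 3) (Z 1) q = 0"
      "\<And>q. q \<in> V \<Longrightarrow> bracket A (Z 2) (Z 3) q = 0"
    and agree: "\<And>\<alpha> f. C_at p f \<Longrightarrow> sum_list (map weight \<alpha>) \<le> 3 \<Longrightarrow>
      iter_lie Z \<alpha> f p = iter_lie X \<alpha> f p"
    by (rule heisenberg_frame[OF assms(4,5) vfU spanU]) (assumption, assumption, rule that)
  have ag: "agree_at A p [Z 1, Z 2, Z 3] [X1, X2, X3] \<alpha>"
    if "multi_index \<alpha>" "weighted_order \<alpha> \<in> {1, 2, 3}" for \<alpha>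
    using agree that(2) unfolding weighted_order_eq_weight[OF that(1)]
    by (auto simp: agree_at_def multi_apply_iter_lie[OF that(1)] simp flip: X)
  \<comment> \<open>Restricted to V, the given frame serves as \<open>Y1\<close>, \<open>Y2\<close>
    in the definition of a flattening.\<close>
  have orth: "orthonormal_frame A H ip V X1 X2"
    using assms(6) V assms(4) unfolding orthonormal_frame_def frame_on_def
    by (auto simp: smooth_section_on_def smooth_vfield_on_iff subset_iff)
  define gZ where "gZ q \<xi> \<eta> = \<xi> (Z 1 q) * \<eta> (Z 1 q) + \<xi> (Z 2 q) * \<eta> (Z 2 q)"
    for q and \<xi> \<eta> :: "'a tvec \<Rightarrow> real"
  have "flattening A H ip g p V gZ (Z 1) (Z 2) (Z 3)"
    unfolding flattening_def
  proof (intro conjI)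
    show "frame_on A V T_at [Z 1, Z 2, Z 3]"
      by (rule frame_onI[OF V(1) vfZ inj indep span_Z])
    show "cometric_of_frame A V (Z 1) (Z 2) gZ"
      by (simp add: cometric_of_frame_def gZ_def)
    show "\<exists>Y1 Y2. orthonormal_frame A H ip V Y1 Y2 \<and>
        (\<forall>\<alpha>. multi_index \<alpha> \<and> weighted_order \<alpha> \<in> {1, 2, 3} \<longrightarrow>
          agree_at A p [Z 1, Z 2, Z 3] [Y1, Y2, bracket A Y1 Y2] \<alpha>)"
      using orth ag unfolding assms(7) by blast
  qed (use assms(3) V br in auto)
  then show "\<exists>Uh ghat Xh1 Xh2 Xh3.
       open Uh \<and> p \<in> Uh \<and> Uh \<subseteq> U \<and>
       flattening A H ip g p Uh ghat Xh1 Xh2 Xh3 \<and>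
       (\<forall>\<alpha>. multi_index \<alpha> \<and> weighted_order \<alpha> \<in> {1, 2, 3} \<longrightarrow>
          agree_at A p [Xh1, Xh2, Xh3] [X1, X2, X3] \<alpha>)"
    using V ag by blast
next
  assume "\<exists>Uh ghat Xh1 Xh2 Xh3.
       open Uh \<and> p \<in> Uh \<and> Uh \<subseteq> U \<and>
       flattening A H ip g p Uh ghat Xh1 Xh2 Xh3 \<and>
       (\<forall>\<alpha>. multi_index \<alpha> \<and> weighted_order \<alpha> \<in> {1, 2, 3} \<longrightarrow>
          agree_at A p [Xh1, Xh2, Xh3] [X1, X2, X3] \<alpha>)"
  then obtain Uh ghat Xh1 Xh2 Xh3 where "flattening A H ip g p Uh ghat Xh1 Xh2 Xh3"
    and "\<And>\<alpha>. multi_index \<alpha> \<Longrightarrow> weighted_order \<alpha> \<in> {1, 2, 3} \<Longrightarrow>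
      agree_at A p [Xh1, Xh2, Xh3] [X1, X2, X3] \<alpha>"
    by blast
  from carnot_if_flattening[OF this] show "carnot_frame A H ip U p X1 X2"
    using assms by (simp add: carnot_frame_def Let_def)
qed

end
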